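(* The automorphism group $\mathrm{Aut}(F_3)$ is large, that is, it has a subgroup of finite index which admits a surjective homomorphism onto a free nonabelian group. In particular, $\mathrm{Aut}(F_3)$ does not have Kazhdan's property (T).
   Context: $F_3$ is the free group of rank $3$ and $\mathrm{Aut}(F_3)$ its automorphism group (a discrete, finitely generated group). *)

theory Defs
  imports "HOL-Analysis.Analysis" "HOL-Algebra.Algebra"
begin

section \<open>Free groups\<close>

text \<open>
  The letter \<open>(s, False)\<close> stands for the generator \<open>s\<close>, and \<open>(s, True)\<close> for its formal inverse.
  The free group on a set \<open>S\<close> is the set of reduced words over \<open>S\<close>, multiplied by concatenation
  followed by free reduction.
\<close>

type_synonym 'a letter = "'a \<times> bool"

definition letter_inv :: "'a letter \<Rightarrow> 'a letter" where
  "letter_inv x = (fst x, \<not> snd x)"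

definition reduced_word :: "'a letter list \<Rightarrow> bool" where
  "reduced_word w \<longleftrightarrow> successively (\<lambda>x y. y \<noteq> letter_inv x) w"

fun reduced_Cons :: "'a letter \<Rightarrow> 'a letter list \<Rightarrow> 'a letter list" where
  "reduced_Cons x [] = [x]"
| "reduced_Cons x (y # w) = (if y = letter_inv x then w else x # y # w)"

definition free_group :: "'a set \<Rightarrow> 'a letter list monoid" where
  "free_group S =
    \<lparr>carrier = {w. fst ` set w \<subseteq> S \<and> reduced_word w},
     mult = (\<lambda>v w. foldr reduced_Cons v w),
     one = []\<rparr>"

lemma letter_inv_inv [simp]: "letter_inv (letter_inv x) = x"
  by (simp add: letter_inv_def)

lemma fst_letter_inv [simp]: "fst (letter_inv x) = fst x"
  by (simp add: letter_inv_def)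

lemma reduced_reduced_Cons: "reduced_word w \<Longrightarrow> reduced_word (reduced_Cons x w)"
  by (cases w) (auto simp: reduced_word_def successively_Cons)

lemma reduced_foldr: "reduced_word w \<Longrightarrow> reduced_word (foldr reduced_Cons v w)"
  by (induction v) (auto intro: reduced_reduced_Cons)

lemma set_reduced_Cons: "set (reduced_Cons x w) \<subseteq> insert x (set w)"
  by (cases w) auto

lemma set_foldr_reduced_Cons: "set (foldr reduced_Cons v w) \<subseteq> set v \<union> set w"
proof (induction v)
  case (Cons x v)
  then show ?case
    using set_reduced_Cons[of x "foldr reduced_Cons v w"] by auto
qed simp

lemma reduced_Cons_cancel:
  "reduced_word w \<Longrightarrow> reduced_Cons x (reduced_Cons (letter_inv x) w) = w"
  by (cases w; cases "tl w") (auto simp: reduced_word_def letter_inv_def)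

lemma foldr_reduced_Cons_Cons:
  assumes "reduced_word w"
  shows "foldr reduced_Cons (reduced_Cons x v) w = reduced_Cons x (foldr reduced_Cons v w)"
proof (cases v)
  case (Cons y u)
  have "reduced_word (foldr reduced_Cons u w)"
    using assms by (rule reduced_foldr)
  then show ?thesis
    using Cons by (auto simp: reduced_Cons_cancel)
qed simp

lemma foldr_reduced_Cons_assoc:
  assumes "reduced_word w"
  shows "foldr reduced_Cons (foldr reduced_Cons u v) w
       = foldr reduced_Cons u (foldr reduced_Cons v w)"
  by (induction u) (simp_all add: foldr_reduced_Cons_Cons assms)

lemma foldr_reduced_Cons_inverse:
  assumes "reduced_word w"
  shows "foldr reduced_Cons (map letter_inv (rev v)) (foldr reduced_Cons v w) = w"
  using assms
proof (induction v arbitrary: w)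
  case (Cons x v)
  have "reduced_Cons (letter_inv x) (reduced_Cons x (foldr reduced_Cons v w))
      = foldr reduced_Cons v w"
    using reduced_Cons_cancel[OF reduced_foldr[OF Cons.prems, of v], of "letter_inv x"] by simp
  then show ?case
    using Cons by simp
qed simp

lemma foldr_reduced_Cons_Nil: "reduced_word w \<Longrightarrow> foldr reduced_Cons w [] = w"
proof (induction w)
  case (Cons x w)
  then show ?case
    by (cases w) (auto simp: reduced_word_def)
qed simp

theorem group_free_group: "group (free_group S)"
proof (rule groupI)
  fix v w assume vw: "v \<in> carrier (free_group S)" "w \<in> carrier (free_group S)"
  show "v \<otimes>\<^bsub>free_group S\<^esub> w \<in> carrier (free_group S)"
  proof -
    have "fst ` set (foldr reduced_Cons v w) \<subseteq> fst ` set v \<union> fst ` set w"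
      using image_mono[OF set_foldr_reduced_Cons[of v w], of fst] by (simp add: image_Un)
    also have "\<dots> \<subseteq> S"
      using vw by (simp add: free_group_def)
    finally show ?thesis
      using vw by (simp add: free_group_def reduced_foldr)
  qed
next
  fix w assume w: "w \<in> carrier (free_group S)"
  let ?v = "foldr reduced_Cons (map letter_inv (rev w)) []"
  have "?v \<in> carrier (free_group S)"
  proof -
    have "fst ` set ?v \<subseteq> fst ` set w"
      using image_mono[OF set_foldr_reduced_Cons[of "map letter_inv (rev w)" "[]"], of fst]
      by (simp add: image_image)
    also have "\<dots> \<subseteq> S"
      using w by (simp add: free_group_def)
    finally show ?thesis
      by (simp add: free_group_def reduced_foldr reduced_word_def[of "[]"])
  qed
  moreover have "?v \<otimes>\<^bsub>free_group S\<^esub> w = \<one>\<^bsub>free_group S\<^esub>"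
  proof -
    have "foldr reduced_Cons ?v w = foldr reduced_Cons (map letter_inv (rev w)) w"
      using w foldr_reduced_Cons_assoc[of w "map letter_inv (rev w)" "[]"]
      by (simp add: free_group_def)
    also have "\<dots> = foldr reduced_Cons (map letter_inv (rev w)) (foldr reduced_Cons w [])"
      using w by (simp add: free_group_def foldr_reduced_Cons_Nil)
    also have "\<dots> = []"
      by (rule foldr_reduced_Cons_inverse) (simp add: reduced_word_def)
    finally show ?thesis
      by (simp add: free_group_def)
  qed
  ultimately show
    "\<exists>v\<in>carrier (free_group S). v \<otimes>\<^bsub>free_group S\<^esub> w = \<one>\<^bsub>free_group S\<^esub>"
    by blast
qed (auto simp: free_group_def foldr_reduced_Cons_assoc reduced_word_def[of "[]"])


section \<open>Large groups\<close>

text \<open>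
  Labelling the generators of the free quotient by elements of \<open>G\<close> is no restriction on its rank:
  given a surjection of a subgroup of \<open>G\<close> onto a free group, a choice of preimages embeds a basis
  into \<open>G\<close>.
\<close>

definition large :: "('g, 'b) monoid_scheme \<Rightarrow> bool" where
  "large G \<longleftrightarrow>
    (\<exists>K. subgroup K G \<and> finite (rcosets\<^bsub>G\<^esub> K) \<and>
      (\<exists>(S :: 'g set) f. \<not> comm_group (free_group S) \<and> f \<in> epi (G\<lparr>carrier := K\<rparr>) (free_group S)))"


section \<open>Hilbert spaces and unitary representations\<close>

definition complex_ring :: "complex ring" where
  "complex_ring = \<lparr>carrier = UNIV, mult = (*), one = 1, ring.zero = 0, add = (+)\<rparr>"

lemma cring_complex_ring: "cring complex_ring"
proof (rule cringI)
  show "abelian_group complex_ring"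
  proof (rule abelian_groupI)
    fix x :: complex
    show "\<exists>y\<in>carrier complex_ring. y \<oplus>\<^bsub>complex_ring\<^esub> x = \<zero>\<^bsub>complex_ring\<^esub>"
      by (rule bexI[of _ "- x"]) (auto simp: complex_ring_def)
  qed (auto simp: complex_ring_def)
  show "Group.comm_monoid complex_ring"
    by (rule comm_monoidI) (auto simp: complex_ring_def)
qed (auto simp: complex_ring_def algebra_simps)

text \<open>The inherited ring fields \<open>mult\<close> and \<open>one\<close> play no role.\<close>

record 'h hilbert = "(complex, 'h) module" +
  cinner :: "'h \<Rightarrow> 'h \<Rightarrow> complex"

definition hnorm :: "('h, 'b) hilbert_scheme \<Rightarrow> 'h \<Rightarrow> real" where
  "hnorm H x = sqrt (Re (cinner H x x))"

text \<open>The value \<open>0\<close> off the carrier is needed because the locale \<^locale>\<open>Metric_space\<close> constrains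
  the distance on the whole type.\<close>

definition hdist :: "('h, 'b) hilbert_scheme \<Rightarrow> 'h \<Rightarrow> 'h \<Rightarrow> real" where
  "hdist H x y = (if x \<in> carrier H \<and> y \<in> carrier H then hnorm H (x \<ominus>\<^bsub>H\<^esub> y) else 0)"

locale hilbert_space = module complex_ring H for H :: "('h, 'b) hilbert_scheme" (structure) +
  assumes cinner_add_left:
      "\<lbrakk>x \<in> carrier H; y \<in> carrier H; z \<in> carrier H\<rbrakk>
        \<Longrightarrow> cinner H (x \<oplus> y) z = cinner H x z + cinner H y z"
    and cinner_smult_left:
      "\<lbrakk>x \<in> carrier H; y \<in> carrier H\<rbrakk> \<Longrightarrow> cinner H (c \<odot> x) y = c * cinner H x y"
    and cinner_commute:
      "\<lbrakk>x \<in> carrier H; y \<in> carrier H\<rbrakk> \<Longrightarrow> cinner H x y = cnj (cinner H y x)"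
    and cinner_pos:
      "\<lbrakk>x \<in> carrier H; x \<noteq> \<zero>\<rbrakk> \<Longrightarrow> 0 < Re (cinner H x x)"
    and complete: "Metric_space.mcomplete (carrier H) (hdist H)"

definition unitary_operators :: "('h, 'b) hilbert_scheme \<Rightarrow> ('h \<Rightarrow> 'h) set" where
  "unitary_operators H =
    {T \<in> Bij (carrier H).
      (\<forall>x\<in>carrier H. \<forall>y\<in>carrier H. T (x \<oplus>\<^bsub>H\<^esub> y) = T x \<oplus>\<^bsub>H\<^esub> T y) \<and>
      (\<forall>c. \<forall>x\<in>carrier H. T (c \<odot>\<^bsub>H\<^esub> x) = c \<odot>\<^bsub>H\<^esub> T x) \<and>
      (\<forall>x\<in>carrier H. \<forall>y\<in>carrier H. cinner H (T x) (T y) = cinner H x y)}"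

definition unitary_group :: "('h, 'b) hilbert_scheme \<Rightarrow> ('h \<Rightarrow> 'h) monoid" where
  "unitary_group H = (BijGroup (carrier H))\<lparr>carrier := unitary_operators H\<rparr>"

text \<open>Groups are discrete here, so representations carry no continuity condition.\<close>

definition unitary_rep ::
  "('g, 'a) monoid_scheme \<Rightarrow> ('h, 'b) hilbert_scheme \<Rightarrow> ('g \<Rightarrow> 'h \<Rightarrow> 'h) \<Rightarrow> bool" where
  "unitary_rep G H \<pi> \<longleftrightarrow> hilbert_space H \<and> \<pi> \<in> hom G (unitary_group H)"


section \<open>Kazhdan's property (T) for discrete groups\<close>

definition has_almost_invariant_vector ::
  "('h, 'b) hilbert_scheme \<Rightarrow> ('g \<Rightarrow> 'h \<Rightarrow> 'h) \<Rightarrow> 'g set \<Rightarrow> real \<Rightarrow> bool" where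
  "has_almost_invariant_vector H \<pi> Q \<epsilon> \<longleftrightarrow>
    (\<exists>\<xi>\<in>carrier H. \<xi> \<noteq> \<zero>\<^bsub>H\<^esub> \<and> (\<forall>g\<in>Q. hnorm H (\<pi> g \<xi> \<ominus>\<^bsub>H\<^esub> \<xi>) < \<epsilon> * hnorm H \<xi>))"

definition has_invariant_vector ::
  "('g, 'a) monoid_scheme \<Rightarrow> ('h, 'b) hilbert_scheme \<Rightarrow> ('g \<Rightarrow> 'h \<Rightarrow> 'h) \<Rightarrow> bool" where
  "has_invariant_vector G H \<pi> \<longleftrightarrow>
    (\<exists>\<xi>\<in>carrier H. \<xi> \<noteq> \<zero>\<^bsub>H\<^esub> \<and> (\<forall>g\<in>carrier G. \<pi> g \<xi> = \<xi>))"

text \<open>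
  HOL cannot quantify over all Hilbert spaces, so \<open>H\<close> ranges over all Hilbert spaces whose
  underlying set is contained in the type \<^typ>\<open>'g \<times> nat \<Rightarrow> complex\<close>. This is no restriction:
  if a representation has a \<open>(Q, \<epsilon>)\<close>-invariant vector \<open>\<xi>\<close>, so does its subrepresentation on the
  closed span of the orbit of \<open>\<xi>\<close>; the Hilbert dimension of the latter is at most the cardinality
  of \<^typ>\<open>'g \<times> nat\<close>, so it is isomorphic to a Hilbert space of square-summable functions on a
  subset of \<^typ>\<open>'g \<times> nat\<close>.
\<close>

definition property_T :: "('g, 'a) monoid_scheme \<Rightarrow> bool" where
  "property_T G \<longleftrightarrow>
    (\<exists>Q \<epsilon>. finite Q \<and> Q \<subseteq> carrier G \<and> 0 < \<epsilon> \<and>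
      (\<forall>(H :: ('g \<times> nat \<Rightarrow> complex) hilbert) \<pi>.
        unitary_rep G H \<pi> \<longrightarrow> has_almost_invariant_vector H \<pi> Q \<epsilon> \<longrightarrow> has_invariant_vector G H \<pi>))"

end

theory Submission
  imports Defs
begin

text \<open>
  Grunewald and Lubotzky obtain linear representations of automorphism groups of free groups from
  finite-index subgroups of the free group; here the subgroup has index \<open>2\<close>. Let \<open>F\<close> be free on
  \<open>x\<^sub>0, x\<^sub>1, x\<^sub>2\<close>, and let \<open>sgn\<close> be the character with \<open>sgn x\<^sub>0 = -1\<close> and \<open>sgn x\<^sub>1 = sgn x\<^sub>2 = 1\<close>. The
  automorphisms that preserve \<open>sgn\<close> form a subgroup of finite index. It acts on the first cohomology of
  \<open>F\<close> with coefficients in \<open>\<int>\<close> twisted by \<open>sgn\<close>, which modulo torsion is \<open>\<int>\<^sup>2\<close>: a cocycle has three free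
  parameters, its values on the generators, and one of them is accounted for by coboundaries. This gives a
  homomorphism to \<open>GL(2, \<int>)\<close> (\<open>cocycle_matrix_hom\<close>).

  The group \<open>GL(2, \<int>)\<close> has a free subgroup of rank \<open>2\<close> and finite index: by Sanov's theorem
  (\<open>sanov_free\<close>), the matrices \<open>(1, 2, 0, 1)\<close> and \<open>(1, 0, 2, 1)\<close> generate freely a group that is
  described by congruences modulo \<open>4\<close>. Its preimage \<open>K\<close> has finite index in the automorphism group,
  since membership depends only on the composite of an automorphism with a fixed homomorphism from \<open>F\<close>
  to a finite group (\<open>finite_index_sanov_automorphisms\<close>).
  The transvections \<open>x\<^sub>2 \<mapsto> x\<^sub>2 x\<^sub>1\<^sup>2\<close> and \<open>x\<^sub>1 \<mapsto> x\<^sub>1 x\<^sub>2\<^sup>2\<close> lie in \<open>K\<close> and have the two generators as their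
  matrices, so \<open>K\<close> maps onto the free group (\<open>large_AutoGroup_F3\<close>).

  No large group has property (T) (\<open>large_not_property_T\<close>). A subgroup \<open>K\<close> of finite index maps onto a
  nontrivial free group and hence onto \<open>\<int>\<close>, and the integers have characters that are nontrivial but
  arbitrarily close to the trivial one. Instead of passing property (T) on to \<open>K\<close> and to its quotient,
  these characters are induced up to the whole group: the induced representations have finite dimension,
  vectors that are arbitrarily close to being invariant, and no invariant vector.
\<close>

section \<open>The universal property of free groups\<close>

definition free_lift :: "('g, 'm) monoid_scheme \<Rightarrow> ('a \<Rightarrow> 'g) \<Rightarrow> 'a letter list \<Rightarrow> 'g" where
  "free_lift G f w =
    foldr (\<lambda>x g. (if snd x then inv\<^bsub>G\<^esub> f (fst x) else f (fst x)) \<otimes>\<^bsub>G\<^esub> g) w \<one>\<^bsub>G\<^esub>"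

lemma free_lift_Nil [simp]: "free_lift G f [] = \<one>\<^bsub>G\<^esub>"
  by (simp add: free_lift_def)

lemma free_lift_Cons [simp]:
  "free_lift G f (x # w) =
    (if snd x then inv\<^bsub>G\<^esub> f (fst x) else f (fst x)) \<otimes>\<^bsub>G\<^esub> free_lift G f w"
  by (simp add: free_lift_def)

lemma letter_in_free_group: "fst x \<in> S \<Longrightarrow> [x] \<in> carrier (free_group S)"
  by (simp add: free_group_def reduced_word_def)

lemma one_free_group [simp]: "\<one>\<^bsub>free_group S\<^esub> = []"
  by (simp add: free_group_def)

lemma mult_free_group: "v \<otimes>\<^bsub>free_group S\<^esub> w = foldr reduced_Cons v w"
  by (simp add: free_group_def)

lemma Cons_in_free_group:
  assumes "x # w \<in> carrier (free_group S)"
  shows "fst x \<in> S" "w \<in> carrier (free_group S)" "x # w = [x] \<otimes>\<^bsub>free_group S\<^esub> w"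
  using assms by (cases w; auto simp: free_group_def reduced_word_def)+

lemma inv_letter_free_group:
  assumes "s \<in> S"
  shows "inv\<^bsub>free_group S\<^esub> [(s, b)] = [(s, \<not> b)]"
  using group.inv_equality[OF group_free_group, where y = "[(s, \<not> b)]" and x = "[(s, b)]"]
  by (simp add: mult_free_group letter_in_free_group assms letter_inv_def)

lemma free_lift_closed:
  assumes "group G" "f \<in> S \<rightarrow> carrier G" "fst ` set w \<subseteq> S"
  shows "free_lift G f w \<in> carrier G"
proof -
  interpret group G by fact
  show ?thesis
    using assms(2,3) by (induction w) auto
qed

theorem free_lift_hom:
  assumes "group G" "f \<in> S \<rightarrow> carrier G"
  shows "free_lift G f \<in> hom (free_group S) G"
proof -
  interpret group G by fact
  note closed = free_lift_closed[OF assms]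
  \<comment> \<open>A cancellation performed by \<^const>\<open>reduced_Cons\<close> is a cancellation in \<open>G\<close>.\<close>
  have reduced: "free_lift G f (reduced_Cons x w) = free_lift G f (x # w)"
    if "fst x \<in> S" "fst ` set w \<subseteq> S" for x w
    using that
  proof (cases w)
    case (Cons y u)
    have "f (fst x) \<in> carrier G" "free_lift G f u \<in> carrier G"
      using assms(2) that closed[of u] Cons by auto
    then show ?thesis
      using Cons by (auto simp: letter_inv_def m_assoc [symmetric])
  qed simp
  have "free_lift G f (foldr reduced_Cons v w) = free_lift G f v \<otimes>\<^bsub>G\<^esub> free_lift G f w"
    if "fst ` set v \<subseteq> S" "fst ` set w \<subseteq> S" for v w
    using that
  proof (induction v)
    case Nil
    then show ?case by (simp add: closed)
  next
    case (Cons x v)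
    have "fst ` set (foldr reduced_Cons v w) \<subseteq> S"
      using Cons.prems set_foldr_reduced_Cons[of v w] by fastforce
    moreover have "f (fst x) \<in> carrier G"
      using assms(2) Cons.prems by auto
    ultimately show ?case
      using Cons closed[of v] closed[of w] by (simp add: reduced m_assoc)
  qed
  then show ?thesis
    using closed by (auto simp: hom_def free_group_def)
qed

lemma free_lift_generator:
  assumes "group G" "f \<in> S \<rightarrow> carrier G" "s \<in> S"
  shows "free_lift G f [(s, False)] = f s"
proof -
  interpret group G by fact
  show ?thesis using assms by (auto simp: Pi_iff)
qed

text \<open>This is the form in which the generators are used: an identity between homomorphisms, and
  likewise a congruence between them, holds on a subgroup.\<close>

lemma free_group_generated:
  assumes "subgroup H (free_group S)" and "\<And>s. s \<in> S \<Longrightarrow> [(s, False)] \<in> H"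
    and "w \<in> carrier (free_group S)"
  shows "w \<in> H"
  using assms(3)
proof (induction w)
  case Nil
  then show ?case
    using subgroup.one_closed[OF assms(1)] by simp
next
  case (Cons x w)
  note x = Cons_in_free_group[OF Cons.prems]
  have "[x] \<in> H"
  proof (cases "snd x")
    case True
    have "[x] = inv\<^bsub>free_group S\<^esub> [(fst x, False)]"
      using x(1) True by (simp add: inv_letter_free_group prod_eq_iff)
    then show ?thesis
      using subgroup.m_inv_closed[OF assms(1)] assms(2) x(1) by simp
  next
    case False
    then show ?thesis
      using assms(2)[OF x(1)] by (metis (full_types) prod.collapse)
  qed
  then show ?case
    using subgroup.m_closed[OF assms(1), of "[x]" w] Cons.IH x(2,3) by simp
qed

lemma free_group_hom_eqI:
  assumes "group G" "h \<in> hom (free_group S) G" "h' \<in> hom (free_group S) G"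
    and "\<And>s. s \<in> S \<Longrightarrow> h [(s, False)] = h' [(s, False)]"
    and "w \<in> carrier (free_group S)"
  shows "h w = h' w"
proof -
  interpret h: group_hom "free_group S" G h
    using assms by (simp add: group_hom_def group_hom_axioms_def group_free_group)
  interpret h': group_hom "free_group S" G h'
    using assms by (simp add: group_hom_def group_hom_axioms_def group_free_group)
  have "subgroup {w \<in> carrier (free_group S). h w = h' w} (free_group S)"
    by (rule h.G.subgroupI) (use h.one_closed h.hom_one h'.hom_one in auto)
  from free_group_generated[OF this _ assms(5)] show ?thesis
    using assms(4) by (simp add: letter_in_free_group)
qed

lemma free_group_not_comm:
  assumes "a \<in> S" "b \<in> S" "a \<noteq> b"
  shows "\<not> comm_group (free_group S)"
proof
  assume "comm_group (free_group S)"
  then interpret comm_group "free_group S" .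
  have "[(a, False)] \<otimes>\<^bsub>free_group S\<^esub> [(b, False)] = [(b, False)] \<otimes>\<^bsub>free_group S\<^esub> [(a, False)]"
    using assms by (intro m_comm letter_in_free_group) auto
  then show False
    using assms by (simp add: mult_free_group letter_inv_def)
qed

section \<open>Automorphism groups and finite index\<close>

lemma AutoGroup_simps:
  "carrier (AutoGroup G) = auto G"
  "\<one>\<^bsub>AutoGroup G\<^esub> = (\<lambda>x\<in>carrier G. x)"
  by (simp_all add: AutoGroup_def BijGroup_def)

lemma auto_closed: "\<phi> \<in> auto G \<Longrightarrow> x \<in> carrier G \<Longrightarrow> \<phi> x \<in> carrier G"
  by (auto simp: auto_def hom_def)

lemma AutoGroup_mult_apply:
  assumes "\<phi> \<in> auto G" "\<psi> \<in> auto G" "x \<in> carrier G"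
  shows "(\<phi> \<otimes>\<^bsub>AutoGroup G\<^esub> \<psi>) x = \<phi> (\<psi> x)"
  using assms by (simp add: AutoGroup_def BijGroup_def auto_def compose_def)

lemma AutoGroup_inv_apply:
  assumes "group G" "\<phi> \<in> auto G" "x \<in> carrier G"
  shows "inv\<^bsub>AutoGroup G\<^esub> \<phi> \<in> auto G" "\<phi> ((inv\<^bsub>AutoGroup G\<^esub> \<phi>) x) = x"
proof -
  interpret A: group "AutoGroup G"
    using assms(1) by (rule group.AutoGroup)
  show inv: "inv\<^bsub>AutoGroup G\<^esub> \<phi> \<in> auto G"
    using A.inv_closed[of \<phi>] assms(2) by (simp add: AutoGroup_simps)
  have "\<phi> ((inv\<^bsub>AutoGroup G\<^esub> \<phi>) x) = (\<phi> \<otimes>\<^bsub>AutoGroup G\<^esub> inv\<^bsub>AutoGroup G\<^esub> \<phi>) x"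
    by (simp add: AutoGroup_mult_apply assms inv)
  also have "\<dots> = x"
    using assms by (simp add: A.r_inv AutoGroup_simps)
  finally show "\<phi> ((inv\<^bsub>AutoGroup G\<^esub> \<phi>) x) = x" .
qed

text \<open>A homomorphism with a two-sided inverse homomorphism restricts to an automorphism in the
  extensional sense of \<^const>\<open>auto\<close>.\<close>

lemma restrict_in_auto:
  assumes "group G" "f \<in> hom G G" "g \<in> hom G G"
    and "\<And>x. x \<in> carrier G \<Longrightarrow> g (f x) = x" "\<And>x. x \<in> carrier G \<Longrightarrow> f (g x) = x"
  shows "restrict f (carrier G) \<in> auto G"
proof -
  interpret group G by fact
  have "bij_betw f (carrier G) (carrier G)"
    using assms by (intro bij_betw_byWitness[where f' = g]) (auto simp: hom_def)
  then have "bij_betw (restrict f (carrier G)) (carrier G) (carrier G)"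
    by (simp cong: bij_betw_cong)
  then show ?thesis
    using assms(2) by (auto simp: auto_def Bij_def hom_def)
qed

lemma (in group_hom) subgroup_preimage:
  assumes "subgroup J H"
  shows "subgroup {x \<in> carrier G. h x \<in> J} G"
proof -
  interpret J: subgroup J H by fact
  show ?thesis
    by (rule G.subgroupI) (use G.one_closed hom_one in auto)
qed

text \<open>All elements with the same value lie in one right coset, so there are at most as many cosets as values.\<close>

lemma (in group) finite_rcosets_if_finite_invariant:
  assumes "subgroup K G" and "finite (I ` carrier G)"
    and inv: "\<And>g h. \<lbrakk>g \<in> carrier G; h \<in> carrier G; I g = I h\<rbrakk> \<Longrightarrow> g \<otimes> inv h \<in> K"
  shows "finite (rcosets K)"
proof -
  have eq: "K #> g = K #> h" if "g \<in> carrier G" "h \<in> carrier G" "I g = I h" for g h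
    using repr_independence[of g K h] subgroup.rcos_module[OF assms(1) is_group] inv that assms(1)
    by metis
  define r where "r i = K #> (SOME g. g \<in> carrier G \<and> I g = i)" for i
  have "K #> g = r (I g)" if "g \<in> carrier G" for g
  proof -
    have "(SOME h. h \<in> carrier G \<and> I h = I g) \<in> carrier G"
      "I (SOME h. h \<in> carrier G \<and> I h = I g) = I g"
      using someI[of "\<lambda>h. h \<in> carrier G \<and> I h = I g" g] that by auto
    then show ?thesis
      unfolding r_def using eq[OF that] by simp
  qed
  then have "rcosets K \<subseteq> r ` I ` carrier G"
    by (auto simp: RCOSETS_def)
  then show ?thesis
    using assms(2) finite_surj by blast
qed

section \<open>Sanov's free subgroup of the modular group\<close>

text \<open>The tuple \<open>(a, b, c, d)\<close> is the matrix with rows \<open>(a, b)\<close> and \<open>(c, d)\<close>.\<close>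

definition GL2Z :: "(int \<times> int \<times> int \<times> int) monoid" where
  "GL2Z =
    \<lparr>carrier = {(a, b, c, d). a * d - b * c = 1 \<or> a * d - b * c = -1},
     mult = (\<lambda>(a, b, c, d) (a', b', c', d').
       (a * a' + b * c', a * b' + b * d', c * a' + d * c', c * b' + d * d')),
     one = (1, 0, 0, 1)\<rparr>"

definition sanov_group :: "(int \<times> int \<times> int \<times> int) set" where
  "sanov_group = {(a, b, c, d). a * d - b * c = 1 \<and> 4 dvd a - 1 \<and> 4 dvd d - 1 \<and> 2 dvd b \<and> 2 dvd c}"

lemma GL2Z_simps [simp]:
  "(a, b, c, d) \<in> carrier GL2Z \<longleftrightarrow> a * d - b * c = 1 \<or> a * d - b * c = -1"
  "(a, b, c, d) \<otimes>\<^bsub>GL2Z\<^esub> (a', b', c', d') =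
    (a * a' + b * c', a * b' + b * d', c * a' + d * c', c * b' + d * d')"
  "\<one>\<^bsub>GL2Z\<^esub> = (1, 0, 0, 1)"
  by (simp_all add: GL2Z_def)

lemma det_mult:
  fixes a b c d a' b' c' d' :: int
  shows "(a * a' + b * c') * (c * b' + d * d') - (a * b' + b * d') * (c * a' + d * c') =
    (a * d - b * c) * (a' * d' - b' * c')"
  by (simp add: algebra_simps)

lemma inverse_GL2Z:
  assumes "(a, b, c, d) \<in> carrier GL2Z"
  defines "e \<equiv> a * d - b * c"
  shows "(e * d, - e * b, - e * c, e * a) \<in> carrier GL2Z"
    and "(e * d, - e * b, - e * c, e * a) \<otimes>\<^bsub>GL2Z\<^esub> (a, b, c, d) = \<one>\<^bsub>GL2Z\<^esub>"
proof -
  have ee: "e = 1 \<or> e = -1"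
    using assms by simp
  have e: "a * d - b * c = e"
    by (simp add: e_def)
  show "(e * d, - e * b, - e * c, e * a) \<in> carrier GL2Z"
    "(e * d, - e * b, - e * c, e * a) \<otimes>\<^bsub>GL2Z\<^esub> (a, b, c, d) = \<one>\<^bsub>GL2Z\<^esub>"
    using ee e by (elim disjE; simp add: algebra_simps)+
qed

lemma group_GL2Z: "group GL2Z"
proof (rule groupI)
  fix x y assume "x \<in> carrier GL2Z" "y \<in> carrier GL2Z"
  then show "x \<otimes>\<^bsub>GL2Z\<^esub> y \<in> carrier GL2Z"
    by (cases x; cases y) (auto simp: det_mult)
next
  fix x y z
  show "x \<otimes>\<^bsub>GL2Z\<^esub> y \<otimes>\<^bsub>GL2Z\<^esub> z = x \<otimes>\<^bsub>GL2Z\<^esub> (y \<otimes>\<^bsub>GL2Z\<^esub> z)"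
    by (cases x; cases y; cases z) (simp add: algebra_simps)
next
  fix x assume "x \<in> carrier GL2Z"
  then show "\<exists>y\<in>carrier GL2Z. y \<otimes>\<^bsub>GL2Z\<^esub> x = \<one>\<^bsub>GL2Z\<^esub>"
    by (cases x) (metis inverse_GL2Z)
next
  fix x assume "x \<in> carrier GL2Z"
  then show "\<one>\<^bsub>GL2Z\<^esub> \<otimes>\<^bsub>GL2Z\<^esub> x = x"
    by (cases x) simp
qed simp

lemma sanov_mult:
  assumes "x \<in> sanov_group" "y \<in> sanov_group"
  shows "x \<otimes>\<^bsub>GL2Z\<^esub> y \<in> sanov_group"
proof -
  obtain a b c d where x: "x = (a, b, c, d)" by (cases x)
  obtain a' b' c' d' where y: "y = (a', b', c', d')" by (cases y)
  have det: "(a * a' + b * c') * (c * b' + d * d') - (a * b' + b * d') * (c * a' + d * c') = 1"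
    using assms by (simp add: det_mult x y sanov_group_def)
  have "4 dvd b * c'" "4 dvd c * b'"
    using assms mult_dvd_mono[of 2 b 2 c'] mult_dvd_mono[of 2 c 2 b']
    by (auto simp: x y sanov_group_def)
  moreover have "4 dvd a * a' - 1"
  proof -
    have "4 dvd a * (a' - 1) + (a - 1)"
      using assms by (intro dvd_add dvd_mult) (auto simp: x y sanov_group_def)
    then show ?thesis
      by (simp add: algebra_simps)
  qed
  moreover have "4 dvd d * d' - 1"
  proof -
    have "4 dvd d * (d' - 1) + (d - 1)"
      using assms by (intro dvd_add dvd_mult) (auto simp: x y sanov_group_def)
    then show ?thesis
      by (simp add: algebra_simps)
  qed
  ultimately have "4 dvd (a * a' - 1) + b * c'" "4 dvd c * b' + (d * d' - 1)"
    using dvd_add by blast+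
  then have "4 dvd (a * a' + b * c') - 1" "4 dvd (c * b' + d * d') - 1"
    by (simp_all add: algebra_simps)
  then show ?thesis
    using det assms by (auto simp: x y sanov_group_def)
qed

lemma subgroup_sanov_group: "subgroup sanov_group GL2Z"
proof -
  interpret group GL2Z by (rule group_GL2Z)
  show ?thesis
  proof (rule subgroupI)
    show "sanov_group \<subseteq> carrier GL2Z"
      by (auto simp: sanov_group_def)
    have "(1, 0, 0, 1) \<in> sanov_group"
      by (simp add: sanov_group_def)
    then show "sanov_group \<noteq> {}"
      by blast
  next
    fix x assume x: "x \<in> sanov_group"
    obtain a b c d where abcd: "x = (a, b, c, d)" by (cases x)
    have det: "a * d - b * c = 1"
      using x by (simp add: abcd sanov_group_def)
    have "inv\<^bsub>GL2Z\<^esub> x = (d, - b, - c, a)"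
      using det inverse_GL2Z[of a b c d] by (intro inv_equality) (auto simp: abcd)
    then show "inv\<^bsub>GL2Z\<^esub> x \<in> sanov_group"
      using x by (auto simp: abcd sanov_group_def algebra_simps)
  qed (rule sanov_mult)
qed

text \<open>For \<open>e = 1\<close> this is the open cone between the directions \<open>(1, 0)\<close> and \<open>(1, 1)\<close> and its
  negative, and for \<open>e = -1\<close> the mirror image of that double cone.\<close>

definition double_cone :: "int \<Rightarrow> int \<Rightarrow> int \<Rightarrow> bool" where
  "double_cone e p q \<longleftrightarrow> 0 < q \<and> q < e * p \<or> e * p < q \<and> q < 0"

text \<open>The shear of sign \<open>e\<close> throws vectors into its own double cone, both from there and from the double
  cones of the shears in the other direction. What is left is the double cone of the inverse shear, which
  would be met by a letter next to its inverse, and a reduced word contains no such pair.\<close>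

lemma double_cone_shear:
  assumes "e = 1 \<or> e = -1" "t = 1 \<or> t = -1"
  shows "double_cone e p q \<Longrightarrow> double_cone e (p + 2 * e * q) q"
    and "double_cone t q p \<Longrightarrow> double_cone e (p + 2 * e * q) q"
  using assms by (auto simp: double_cone_def)

text \<open>A matrix of the group is reduced to a power of a shear by the Euclidean algorithm on its first
  column. Adding or subtracting twice the smaller entry makes the larger one strictly smaller, provided
  that the absolute values differ, and they do because \<open>a\<close> is odd and \<open>c\<close> is even.\<close>

lemma sanov_group_generated:
  assumes H: "subgroup H GL2Z" and A: "(1, 2, 0, 1) \<in> H" and B: "(1, 0, 2, 1) \<in> H"
  shows "sanov_group \<subseteq> H"
proof -
  interpret group GL2Z by (rule group_GL2Z)
  have inv: "inv\<^bsub>GL2Z\<^esub> (1, 2, 0, 1) = (1, -2, 0, 1)" "inv\<^bsub>GL2Z\<^esub> (1, 0, 2, 1) = (1, 0, -2, 1)"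
    by (rule inv_equality; simp)+
  have A': "(1, 2 * e, 0, 1) \<in> H" and B': "(1, 0, 2 * e, 1) \<in> H" if "e = 1 \<or> e = -1" for e
    using that A B subgroup.m_inv_closed[OF H A] subgroup.m_inv_closed[OF H B] inv by auto
  have power: "(1, 2 * k, 0, 1) \<in> H" for k :: int
  proof (induction k rule: int_induct[of _ 0])
    case base
    then show ?case using subgroup.one_closed[OF H] by simp
  next
    case (step1 i)
    then show ?case
      using subgroup.m_closed[OF H A'[of 1] step1(2)] by (simp add: algebra_simps)
  next
    case (step2 i)
    then show ?case
      using subgroup.m_closed[OF H A'[of "-1"] step2(2)] by (simp add: algebra_simps)
  qed
  have "(a, b, c, d) \<in> H" if "(a, b, c, d) \<in> sanov_group" for a b c d
    using that
  proof (induction "nat (\<bar>a\<bar> + \<bar>c\<bar>)" arbitrary: a b c d rule: less_induct)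
    case less
    have det: "a * d - b * c = 1" and mod: "4 dvd a - 1" "4 dvd d - 1" "2 dvd b" "2 dvd c"
      using less.prems by (auto simp: sanov_group_def)
    have odd: "odd a"
      using mod(1) by presburger
    then have "a \<noteq> 0"
      by auto
    have step: "(a, b, c, d) \<in> H"
      if U: "U \<in> H" "U \<in> sanov_group" and V: "V \<in> sanov_group" "U \<otimes>\<^bsub>GL2Z\<^esub> (a, b, c, d) = V"
        and smaller: "\<bar>fst V\<bar> + \<bar>fst (snd (snd V))\<bar> < \<bar>a\<bar> + \<bar>c\<bar>" for U V
    proof -
      have "V \<in> H"
        using less.hyps[of "fst V" "fst (snd (snd V))" "fst (snd V)" "snd (snd (snd V))"]
          V(1) smaller by simp
      have "inv\<^bsub>GL2Z\<^esub> U \<otimes>\<^bsub>GL2Z\<^esub> (U \<otimes>\<^bsub>GL2Z\<^esub> x) = x"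
        if "x \<in> carrier GL2Z" for x
        using that subgroup.mem_carrier[OF H U(1)] by (simp add: m_assoc [symmetric])
      from this[of "(a, b, c, d)"] have "(a, b, c, d) = inv\<^bsub>GL2Z\<^esub> U \<otimes>\<^bsub>GL2Z\<^esub> V"
        using det V(2) by simp
      then show ?thesis
        using subgroup.m_closed[OF H subgroup.m_inv_closed[OF H U(1)] \<open>V \<in> H\<close>] by simp
    qed
    have sheared: "U \<otimes>\<^bsub>GL2Z\<^esub> (a, b, c, d) \<in> sanov_group" if "U \<in> sanov_group" for U
      using sanov_mult that less.prems by blast
    show ?case
    proof (cases "c = 0")
      case True
      have "a dvd 1"
        using det True by (metis diff_zero dvd_triv_left mult_zero_right)
      then have "a = 1 \<or> a = -1"
        by (simp add: zdvd1_eq abs_eq_iff')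
      then have "a = 1"
        using mod(1) by (elim disjE) simp_all
      then show ?thesis
        using det True mod(3) power by (auto elim: evenE)
    next
      case c: False
      consider "\<bar>c\<bar> < \<bar>a\<bar>" | "\<bar>a\<bar> < \<bar>c\<bar>"
        using odd mod(4) by (metis abs_eq_iff dvd_minus_iff linorder_neqE_linordered_idom)
      then show ?thesis
      proof cases
        case 1
        then obtain e :: int where e: "e = 1 \<or> e = -1" "\<bar>a + 2 * e * c\<bar> < \<bar>a\<bar>"
          using c that[of 1] that[of "-1"] by fastforce
        have "(1, 2 * e, 0, 1) \<in> sanov_group"
          by (simp add: sanov_group_def)
        from step[OF A'[OF e(1)] this sheared[OF this] refl] show ?thesis
          using e by simp
      next
        case 2
        then obtain e :: int where e: "e = 1 \<or> e = -1" "\<bar>c + 2 * e * a\<bar> < \<bar>c\<bar>"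
          using \<open>a \<noteq> 0\<close> that[of 1] that[of "-1"] by fastforce
        have "(1, 0, 2 * e, 1) \<in> sanov_group"
          by (simp add: sanov_group_def)
        from step[OF B'[OF e(1)] this sheared[OF this] refl] show ?thesis
          using e by (simp add: algebra_simps)
      qed
    qed
  qed
  then show ?thesis
    by auto
qed

text \<open>Injectivity is the ping-pong argument: the product of a nonempty reduced word moves a suitable
  coordinate vector into the double cone of the first letter, and no double cone contains a coordinate
  vector. Surjectivity is the Euclidean algorithm above.\<close>

theorem sanov_free:
  fixes a b :: 's
  assumes h: "h \<in> hom (free_group {a, b}) GL2Z"
    and ha: "h [(a, False)] = (1, 2, 0, 1)" and hb: "h [(b, False)] = (1, 0, 2, 1)"
  shows "h \<in> iso (free_group {a, b}) (GL2Z\<lparr>carrier := sanov_group\<rparr>)"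
proof -
  interpret h: group_hom "free_group {a, b}" GL2Z h
    using h by (simp add: group_hom_def group_hom_axioms_def group_free_group group_GL2Z)
  have ne: "a \<noteq> b"
    using ha hb by auto
  define sign :: "'s letter \<Rightarrow> int" where "sign x = (if snd x then -1 else 1)" for x
  have sign: "sign x = 1 \<or> sign x = -1" for x
    by (simp add: sign_def)
  have inv: "inv\<^bsub>GL2Z\<^esub> (1, 2, 0, 1) = (1, -2, 0, 1)" "inv\<^bsub>GL2Z\<^esub> (1, 0, 2, 1) = (1, 0, -2, 1)"
    by (rule h.H.inv_equality; simp)+
  have letter: "h [x] = (if fst x = a then (1, 2 * sign x, 0, 1) else (1, 0, 2 * sign x, 1))"
    if "fst x \<in> {a, b}" for x
  proof (cases x)
    case (Pair s t)
    have "h [(s, True)] = inv\<^bsub>GL2Z\<^esub> (h [(s, False)])"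
      using h.hom_inv[OF letter_in_free_group[of "(s, False)"]] that Pair
        inv_letter_free_group[of s "{a, b}" False] by simp
    then show ?thesis
      using that ne Pair by (cases t) (auto simp: sign_def ha hb inv)
  qed
  define act :: "int \<times> int \<times> int \<times> int \<Rightarrow> int \<times> int \<Rightarrow> int \<times> int"
    where "act = (\<lambda>(a, b, c, d) (p, q). (a * p + b * q, c * p + d * q))"
  have act_mult: "act (U \<otimes>\<^bsub>GL2Z\<^esub> V) v = act U (act V v)" for U V v
    by (cases U; cases V; cases v) (simp add: act_def algebra_simps)
  define attracting where "attracting x v \<longleftrightarrow>
    (if fst x = a then double_cone (sign x) (fst v) (snd v) else double_cone (sign x) (snd v) (fst v))"
    for x v
  define v0 :: "'s letter list \<Rightarrow> int \<times> int"
    where "v0 w = (if fst (last w) = a then (0, 1) else (1, 0))" for w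
  \<comment> \<open>No vector is thrown into the right cone by all four letters, so the starting vector depends on the
    last letter: it lies on the axis that this letter moves.\<close>
  have ping_pong: "attracting (hd w) (act (h w) (v0 w))"
    if "w \<in> carrier (free_group {a, b})" "w \<noteq> []" for w
    using that
  proof (induction w)
    case (Cons x w)
    note x = Cons_in_free_group[OF Cons.prems(1)]
    show ?case
    proof (cases w)
      case Nil
      then show ?thesis
        using letter[OF x(1)] sign[of x] x(1) ne
        by (auto simp: v0_def attracting_def act_def double_cone_def)
    next
      case (Cons y u)
      obtain p q where pq: "act (h w) (v0 w) = (p, q)"
        by (cases "act (h w) (v0 w)")
      have "v0 (x # w) = v0 w"
        using Cons by (simp add: v0_def)
      moreover have "h (x # w) = h [x] \<otimes>\<^bsub>GL2Z\<^esub> h w"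
        using h.hom_mult[OF letter_in_free_group[of x "{a, b}"] x(2)] x(1,3) by simp
      ultimately have "act (h (x # w)) (v0 (x # w)) = act (h [x]) (p, q)"
        by (simp add: act_mult pq)
      then have shear: "act (h (x # w)) (v0 (x # w)) =
          (if fst x = a then (p + 2 * sign x * q, q) else (p, q + 2 * sign x * p))"
        using letter[OF x(1)] by (simp add: act_def)
      have y: "attracting y (p, q)"
        using Cons.IH x(2) Cons pq by simp
      have "fst y \<in> {a, b}"
        using Cons x(2) Cons_in_free_group(1) by blast
      have "sign y = sign x" if "fst y = fst x"
        using Cons.prems(1) that Cons
        by (auto simp: free_group_def reduced_word_def letter_inv_def sign_def prod_eq_iff)
      then show ?thesis
        using y double_cone_shear[OF sign[of x] sign[of y]] \<open>fst y \<in> {a, b}\<close> x(1) ne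
        by (auto simp: shear attracting_def)
    qed
  qed simp
  have "w = []" if "w \<in> carrier (free_group {a, b})" "h w = \<one>\<^bsub>GL2Z\<^esub>" for w
  proof (rule ccontr)
    assume "w \<noteq> []"
    from ping_pong[OF that(1) this] show False
      by (auto simp: that(2) attracting_def act_def v0_def double_cone_def split: if_splits)
  qed
  then have inj: "inj_on h (carrier (free_group {a, b}))"
    by (simp add: h.inj_on_one_iff)
  have image: "subgroup (h ` carrier (free_group {a, b})) GL2Z"
    by (rule h.img_is_subgroup)
  have gens: "(1, 2, 0, 1) \<in> h ` carrier (free_group {a, b})"
    "(1, 0, 2, 1) \<in> h ` carrier (free_group {a, b})"
    using ha hb letter_in_free_group[of "(a, False)" "{a, b}"]
      letter_in_free_group[of "(b, False)" "{a, b}"] by (metis fst_conv image_eqI insertCI)+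
  have "subgroup {w \<in> carrier (free_group {a, b}). h w \<in> sanov_group} (free_group {a, b})"
    by (rule h.subgroup_preimage[OF subgroup_sanov_group])
  moreover have "[(s, False)] \<in> {w \<in> carrier (free_group {a, b}). h w \<in> sanov_group}"
    if "s \<in> {a, b}" for s
    using that ha hb by (auto simp: letter_in_free_group sanov_group_def)
  ultimately have "h w \<in> sanov_group" if "w \<in> carrier (free_group {a, b})" for w
    using free_group_generated that by blast
  then have "h ` carrier (free_group {a, b}) = sanov_group"
    using sanov_group_generated[OF image gens] by auto
  then show ?thesis
    using inj h.hom_mult by (auto simp: iso_def hom_def bij_betw_def)
qed

section \<open>A finite-index subgroup acting on twisted cohomology\<close>

text \<open>The semidirect product of the plane \<open>\<int>\<^sup>2\<close> with the group of signs, which acts by negation; \<open>(s, p, q)\<close>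
  is the affine map \<open>v \<mapsto> s v + (p, q)\<close>.\<close>

definition twisted_plane :: "(int \<times> int \<times> int) monoid" where
  "twisted_plane =
    \<lparr>carrier = {(s, p, q). s = 1 \<or> s = -1},
     mult = (\<lambda>(s, p, q) (s', p', q'). (s * s', p + s * p', q + s * q')),
     one = (1, 0, 0)\<rparr>"

lemma twisted_plane_simps [simp]:
  "(s, p, q) \<in> carrier twisted_plane \<longleftrightarrow> s = 1 \<or> s = -1"
  "(s, p, q) \<otimes>\<^bsub>twisted_plane\<^esub> (s', p', q') = (s * s', p + s * p', q + s * q')"
  "\<one>\<^bsub>twisted_plane\<^esub> = (1, 0, 0)"
  by (simp_all add: twisted_plane_def)

lemma group_twisted_plane: "group twisted_plane"
proof (rule groupI)
  fix x assume "x \<in> carrier twisted_plane"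
  then show "\<exists>y\<in>carrier twisted_plane. y \<otimes>\<^bsub>twisted_plane\<^esub> x = \<one>\<^bsub>twisted_plane\<^esub>"
    by (intro bexI[of _ "(fst x, - fst x * fst (snd x), - fst x * snd (snd x))"]) (cases x; auto)+
qed (auto simp: algebra_simps)

lemma inv_twisted_plane:
  "s = 1 \<or> s = -1 \<Longrightarrow> inv\<^bsub>twisted_plane\<^esub> (s, p, q) = (s, - (s * p), - (s * q))"
  by (rule group.inv_equality[OF group_twisted_plane]) auto

abbreviation F3 :: "nat letter list monoid" where
  "F3 \<equiv> free_group {..<3}"

text \<open>Let the generators be \<open>x\<^sub>0, x\<^sub>1, x\<^sub>2\<close>. The first component is the character that is \<open>-1\<close> on \<open>x\<^sub>0\<close> and
  \<open>1\<close> on the others. The other two components are cocycles with values in the integers twisted by this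
  character. Together with the rational coboundary \<open>g \<mapsto> (1 - sgn g) / 2\<close> they form a basis of the rational
  cocycles, so their classes are a basis of the twisted first cohomology.\<close>

definition cocycle_rep :: "nat letter list \<Rightarrow> int \<times> int \<times> int" where
  "cocycle_rep = free_lift twisted_plane
    (\<lambda>i. (if i = 0 then -1 else 1, of_bool (i = 1), of_bool (i = 2)))"

lemma cocycle_rep_hom: "cocycle_rep \<in> hom F3 twisted_plane"
  unfolding cocycle_rep_def by (rule free_lift_hom[OF group_twisted_plane]) auto

lemma cocycle_rep_generator:
  "cocycle_rep [(i, False)] = (if i = 0 then -1 else 1, of_bool (i = 1), of_bool (i = 2))"
  by (simp add: cocycle_rep_def)

lemma cocycle_rep_auto_hom:
  "\<phi> \<in> auto F3 \<Longrightarrow> cocycle_rep \<circ> \<phi> \<in> hom F3 twisted_plane"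
  using cocycle_rep_hom by (auto simp: auto_def intro: Group.hom_compose)

lemma F3_generator: "i < 3 \<Longrightarrow> [(i, b)] \<in> carrier F3"
  by (rule letter_in_free_group) simp

lemma less_3_cases: "i < (3::nat) \<Longrightarrow> i = 0 \<or> i = 1 \<or> i = 2"
  by auto

definition sign_stabilizer :: "(nat letter list \<Rightarrow> nat letter list) set" where
  "sign_stabilizer =
    {\<phi> \<in> auto F3. \<forall>g\<in>carrier F3. fst (cocycle_rep (\<phi> g)) = fst (cocycle_rep g)}"

text \<open>The matrix of the action on twisted cohomology in the basis given by \<^const>\<open>cocycle_rep\<close>. Its columns
  are read off at \<open>x\<^sub>1\<close> and \<open>x\<^sub>2\<close>, where the character is trivial and coboundaries vanish.\<close>

definition cocycle_matrix :: "(nat letter list \<Rightarrow> nat letter list) \<Rightarrow> int \<times> int \<times> int \<times> int" where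
  "cocycle_matrix \<phi> =
    (let (_, a, c) = cocycle_rep (\<phi> [(1, False)]); (_, b, d) = cocycle_rep (\<phi> [(2, False)])
     in (a, b, c, d))"

lemma sign_stabilizerI:
  assumes \<phi>: "\<phi> \<in> auto F3"
    and "\<And>i. i < 3 \<Longrightarrow> fst (cocycle_rep (\<phi> [(i, False)])) = fst (cocycle_rep [(i, False)])"
  shows "\<phi> \<in> sign_stabilizer"
proof -
  define sgn :: "int \<times> int \<times> int \<Rightarrow> int \<times> int \<times> int" where "sgn = (\<lambda>(s, p, q). (s, 0, 0))"
  have sgn: "sgn \<in> hom twisted_plane twisted_plane"
    by (auto simp: hom_def sgn_def)
  have sgn_eq: "sgn x = sgn y \<longleftrightarrow> fst x = fst y" for x y
    by (auto simp: sgn_def split: prod.splits)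
  have "(sgn \<circ> (cocycle_rep \<circ> \<phi>)) g = (sgn \<circ> cocycle_rep) g" if "g \<in> carrier F3" for g
  proof (rule free_group_hom_eqI[OF group_twisted_plane _ _ _ that])
    show "sgn \<circ> (cocycle_rep \<circ> \<phi>) \<in> hom F3 twisted_plane"
      by (rule Group.hom_compose[OF cocycle_rep_auto_hom[OF \<phi>] sgn])
    show "sgn \<circ> cocycle_rep \<in> hom F3 twisted_plane"
      by (rule Group.hom_compose[OF cocycle_rep_hom sgn])
  qed (use assms(2) in \<open>simp add: sgn_eq\<close>)
  then show ?thesis
    using \<phi> by (simp add: sign_stabilizer_def sgn_eq)
qed

text \<open>An automorphism that preserves the character pulls cocycles back to cocycles, so \<open>cocycle_rep \<circ> \<phi>\<close>
  is \<^const>\<open>cocycle_rep\<close> followed by a linear map and corrected by a multiple of the coboundary. The latter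
  is concentrated on the elements with sign \<open>-1\<close>, and its coefficients \<open>u\<close> and \<open>v\<close> are seen at \<open>x\<^sub>0\<close>. Both
  sides are homomorphisms, so it suffices to compare them on the generators.\<close>

lemma cocycle_rep_sign_stabilizer:
  assumes \<phi>: "\<phi> \<in> sign_stabilizer" and M: "cocycle_matrix \<phi> = (a, b, c, d)"
    and u: "cocycle_rep (\<phi> [(0, False)]) = (s, u, v)"
    and g: "g \<in> carrier F3" "cocycle_rep g = (t, p, q)"
  shows "cocycle_rep (\<phi> g) =
    (t, a * p + b * q + (if t = 1 then 0 else u), c * p + d * q + (if t = 1 then 0 else v))"
proof -
  define \<Theta> :: "int \<times> int \<times> int \<Rightarrow> int \<times> int \<times> int" where "\<Theta> = (\<lambda>(t, p, q). (t,
    a * p + b * q + (if t = 1 then 0 else u), c * p + d * q + (if t = 1 then 0 else v)))"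
  have \<Theta>: "\<Theta> \<in> hom twisted_plane twisted_plane"
    by (auto simp: hom_def \<Theta>_def algebra_simps)
  have auto: "\<phi> \<in> auto F3"
    using \<phi> by (simp add: sign_stabilizer_def)
  have sign: "fst (cocycle_rep (\<phi> [(i, False)])) = fst (cocycle_rep [(i, False)])" if "i < 3" for i
    using \<phi> that F3_generator by (auto simp: sign_stabilizer_def)
  have "(cocycle_rep \<circ> \<phi>) g = (\<Theta> \<circ> cocycle_rep) g"
  proof (rule free_group_hom_eqI[OF group_twisted_plane cocycle_rep_auto_hom[OF auto] _ _ g(1)])
    show "\<Theta> \<circ> cocycle_rep \<in> hom F3 twisted_plane"
      by (rule Group.hom_compose[OF cocycle_rep_hom \<Theta>])
    fix i :: nat assume "i \<in> {..<3}"
    then have i: "i < 3" by simp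
    show "(cocycle_rep \<circ> \<phi>) [(i, False)] = (\<Theta> \<circ> cocycle_rep) [(i, False)]"
      using less_3_cases[OF i] sign[OF i] M u
      by (auto simp: \<Theta>_def cocycle_rep_generator cocycle_matrix_def Let_def split: prod.splits)
  qed
  then show ?thesis
    by (simp add: \<Theta>_def g(2))
qed

text \<open>The coboundary term drops out because \<open>\<psi>\<close> maps \<open>x\<^sub>1\<close> and \<open>x\<^sub>2\<close> to elements with sign \<open>1\<close>.\<close>

lemma cocycle_matrix_mult:
  assumes "\<phi> \<in> sign_stabilizer" "\<psi> \<in> sign_stabilizer"
  shows "cocycle_matrix (\<phi> \<otimes>\<^bsub>AutoGroup F3\<^esub> \<psi>) = cocycle_matrix \<phi> \<otimes>\<^bsub>GL2Z\<^esub> cocycle_matrix \<psi>"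
proof -
  have auto: "\<phi> \<in> auto F3" "\<psi> \<in> auto F3"
    using assms by (auto simp: sign_stabilizer_def)
  obtain a b c d where M: "cocycle_matrix \<phi> = (a, b, c, d)" by (cases "cocycle_matrix \<phi>")
  obtain s u v where u: "cocycle_rep (\<phi> [(0, False)]) = (s, u, v)"
    by (cases "cocycle_rep (\<phi> [(0, False)])")
  have column: "cocycle_rep ((\<phi> \<otimes>\<^bsub>AutoGroup F3\<^esub> \<psi>) [(i, False)]) = (1, a * p + b * q, c * p + d * q)"
    if i: "i = 1 \<or> i = 2" and pq: "cocycle_rep (\<psi> [(i, False)]) = (t, p, q)" for i t p q
  proof -
    have "i < 3"
      using i by auto
    then have "fst (cocycle_rep (\<psi> [(i, False)])) = fst (cocycle_rep [(i, False)])"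
      using assms(2) F3_generator by (auto simp: sign_stabilizer_def)
    then have "t = 1"
      using pq i by (auto simp: cocycle_rep_generator)
    then show ?thesis
      using cocycle_rep_sign_stabilizer[OF assms(1) M u auto_closed[OF auto(2) F3_generator] pq]
        \<open>i < 3\<close> by (simp add: AutoGroup_mult_apply[OF auto] F3_generator)
  qed
  obtain t p q where 1: "cocycle_rep (\<psi> [(1, False)]) = (t, p, q)"
    by (cases "cocycle_rep (\<psi> [(1, False)])")
  obtain t' p' q' where 2: "cocycle_rep (\<psi> [(2, False)]) = (t', p', q')"
    by (cases "cocycle_rep (\<psi> [(2, False)])")
  have "cocycle_matrix \<psi> = (p, p', q, q')"
    using 1 2 by (simp add: cocycle_matrix_def)
  then show ?thesis
    using column[OF _ 1] column[OF _ 2] M by (simp add: cocycle_matrix_def)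
qed

lemma group_AutoGroup_F3: "group (AutoGroup F3)"
  by (rule group.AutoGroup[OF group_free_group])

lemma subgroup_sign_stabilizer: "subgroup sign_stabilizer (AutoGroup F3)"
proof -
  interpret group "AutoGroup F3" by (rule group_AutoGroup_F3)
  show ?thesis
  proof (rule subgroup.intro)
    show "sign_stabilizer \<subseteq> carrier (AutoGroup F3)"
      by (auto simp: sign_stabilizer_def AutoGroup_simps)
    show "\<one>\<^bsub>AutoGroup F3\<^esub> \<in> sign_stabilizer"
      using one_closed by (simp add: sign_stabilizer_def AutoGroup_simps)
  next
    fix \<phi> \<psi> assume *: "\<phi> \<in> sign_stabilizer" "\<psi> \<in> sign_stabilizer"
    then show "\<phi> \<otimes>\<^bsub>AutoGroup F3\<^esub> \<psi> \<in> sign_stabilizer"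
      using m_closed[of \<phi> \<psi>]
      by (auto simp: sign_stabilizer_def AutoGroup_simps AutoGroup_mult_apply auto_closed)
  next
    fix \<phi> assume \<phi>: "\<phi> \<in> sign_stabilizer"
    then have auto: "\<phi> \<in> auto F3"
      by (simp add: sign_stabilizer_def)
    note inv = AutoGroup_inv_apply[OF group_free_group auto]
    show "inv\<^bsub>AutoGroup F3\<^esub> \<phi> \<in> sign_stabilizer"
      unfolding sign_stabilizer_def
    proof (intro CollectI conjI ballI)
      show "inv\<^bsub>AutoGroup F3\<^esub> \<phi> \<in> auto F3"
        using inv(1)[of "[]"] group.is_monoid[OF group_free_group, THEN monoid.one_closed, of "{..<3}"]
        by simp
      fix g assume g: "g \<in> carrier F3"
      have "fst (cocycle_rep (\<phi> ((inv\<^bsub>AutoGroup F3\<^esub> \<phi>) g))) =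
          fst (cocycle_rep ((inv\<^bsub>AutoGroup F3\<^esub> \<phi>) g))"
        using \<phi> auto_closed[OF inv(1)[OF g] g] unfolding sign_stabilizer_def by blast
      then show "fst (cocycle_rep ((inv\<^bsub>AutoGroup F3\<^esub> \<phi>) g)) = fst (cocycle_rep g)"
        by (simp add: inv(2)[OF g])
    qed
  qed
qed

lemma cocycle_matrix_hom:
  "cocycle_matrix \<in> hom ((AutoGroup F3)\<lparr>carrier := sign_stabilizer\<rparr>) GL2Z"
proof -
  interpret A: group "AutoGroup F3" by (rule group_AutoGroup_F3)
  interpret S: subgroup sign_stabilizer "AutoGroup F3" by (rule subgroup_sign_stabilizer)
  have "cocycle_matrix \<phi> \<in> carrier GL2Z" if \<phi>: "\<phi> \<in> sign_stabilizer" for \<phi>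
  proof -
    obtain a b c d where M: "cocycle_matrix \<phi> = (a, b, c, d)"
      by (cases "cocycle_matrix \<phi>")
    obtain a' b' c' d' where N: "cocycle_matrix (inv\<^bsub>AutoGroup F3\<^esub> \<phi>) = (a', b', c', d')"
      by (cases "cocycle_matrix (inv\<^bsub>AutoGroup F3\<^esub> \<phi>)")
    have "cocycle_matrix \<one>\<^bsub>AutoGroup F3\<^esub> = (1, 0, 0, 1)"
      by (simp add: cocycle_matrix_def AutoGroup_simps F3_generator cocycle_rep_generator)
    then have "(a, b, c, d) \<otimes>\<^bsub>GL2Z\<^esub> (a', b', c', d') = (1, 0, 0, 1)"
      using cocycle_matrix_mult[OF \<phi> S.m_inv_closed[OF \<phi>]] S.mem_carrier[OF \<phi>] M N by simp
    then have "(a * d - b * c) * (a' * d' - b' * c') = 1"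
      using det_mult[of a a' b c' c b' d d'] by simp
    then show ?thesis
      using M by (auto simp: zmult_eq_1_iff)
  qed
  then show ?thesis
    by (auto simp: hom_def cocycle_matrix_mult)
qed

definition sanov_automorphisms :: "(nat letter list \<Rightarrow> nat letter list) set" where
  "sanov_automorphisms = {\<phi> \<in> sign_stabilizer. cocycle_matrix \<phi> \<in> sanov_group}"

lemma subgroup_sanov_automorphisms: "subgroup sanov_automorphisms (AutoGroup F3)"
proof -
  interpret A: group "AutoGroup F3" by (rule group_AutoGroup_F3)
  interpret h: group_hom "(AutoGroup F3)\<lparr>carrier := sign_stabilizer\<rparr>" GL2Z cocycle_matrix
    using A.subgroup_imp_group[OF subgroup_sign_stabilizer] cocycle_matrix_hom
    by (simp add: group_hom_def group_hom_axioms_def group_GL2Z)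
  have "subgroup sanov_automorphisms ((AutoGroup F3)\<lparr>carrier := sign_stabilizer\<rparr>)"
    using h.subgroup_preimage[OF subgroup_sanov_group] by (simp add: sanov_automorphisms_def)
  then show ?thesis
    by (rule A.incl_subgroup[OF subgroup_sign_stabilizer])
qed

definition reduce_mod4 :: "int \<times> int \<times> int \<Rightarrow> int \<times> int \<times> int" where
  "reduce_mod4 = (\<lambda>(s, p, q). (s, p mod 4, q mod 4))"

text \<open>Reduction modulo \<open>4\<close> is a congruence on the twisted plane, so agreement of two homomorphisms modulo
  \<open>4\<close> can be checked on generators.\<close>

lemma cocycle_rep_cong_mod4:
  assumes "\<phi> \<in> auto F3" "\<psi> \<in> auto F3"
    and gen: "\<And>i. i < 3 \<Longrightarrow>
      reduce_mod4 (cocycle_rep (\<phi> [(i, False)])) = reduce_mod4 (cocycle_rep (\<psi> [(i, False)]))"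
    and "g \<in> carrier F3"
  shows "reduce_mod4 (cocycle_rep (\<phi> g)) = reduce_mod4 (cocycle_rep (\<psi> g))"
proof -
  interpret f: group_hom F3 twisted_plane "cocycle_rep \<circ> \<phi>"
    using cocycle_rep_auto_hom[OF assms(1)]
    by (simp add: group_hom_def group_hom_axioms_def group_free_group group_twisted_plane)
  interpret g: group_hom F3 twisted_plane "cocycle_rep \<circ> \<psi>"
    using cocycle_rep_auto_hom[OF assms(2)]
    by (simp add: group_hom_def group_hom_axioms_def group_free_group group_twisted_plane)
  have mult: "reduce_mod4 (x \<otimes>\<^bsub>twisted_plane\<^esub> y) = reduce_mod4 (x' \<otimes>\<^bsub>twisted_plane\<^esub> y')"
    if "reduce_mod4 x = reduce_mod4 x'" "reduce_mod4 y = reduce_mod4 y'" for x y x' y'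
    using that by (cases x; cases y; cases x'; cases y')
      (auto simp: reduce_mod4_def intro!: mod_add_cong mod_mult_cong)
  have inv: "reduce_mod4 (inv\<^bsub>twisted_plane\<^esub> x) = reduce_mod4 (inv\<^bsub>twisted_plane\<^esub> x')"
    if "reduce_mod4 x = reduce_mod4 x'" "x \<in> carrier twisted_plane" for x x'
    using that by (cases x; cases x')
      (auto simp: reduce_mod4_def inv_twisted_plane intro!: mod_minus_cong)
  let ?E = "{g \<in> carrier F3. reduce_mod4 ((cocycle_rep \<circ> \<phi>) g) = reduce_mod4 ((cocycle_rep \<circ> \<psi>) g)}"
  have "subgroup ?E F3"
  proof (rule f.G.subgroupI)
    show "?E \<noteq> {}"
      using f.one_closed f.hom_one g.hom_one by fastforce
    fix x assume "x \<in> ?E"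
    then show "inv\<^bsub>F3\<^esub> x \<in> ?E"
      using inv f.hom_closed[of x] f.hom_inv[of x] g.hom_inv[of x] by simp
    fix y assume "y \<in> ?E"
    then show "x \<otimes>\<^bsub>F3\<^esub> y \<in> ?E"
      using mult[of "cocycle_rep (\<phi> x)" "cocycle_rep (\<psi> x)" "cocycle_rep (\<phi> y)" "cocycle_rep (\<psi> y)"]
        \<open>x \<in> ?E\<close> f.hom_mult[of x y] g.hom_mult[of x y] by simp
  qed auto
  from free_group_generated[OF this _ assms(4)] show ?thesis
    using gen F3_generator by simp
qed

text \<open>An automorphism that acts trivially on \<^const>\<open>cocycle_rep\<close> modulo \<open>4\<close> preserves the character, and its
  matrix is the identity modulo \<open>4\<close>. The determinant is \<open>1\<close> or \<open>-1\<close> and congruent to \<open>1\<close> modulo \<open>4\<close>, hence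
  \<open>1\<close>, so the matrix is in Sanov's group. Hence the values modulo \<open>4\<close> of \<open>cocycle_rep \<circ> \<phi>\<close> on the
  generators, of which there are finitely many, determine the coset of \<open>\<phi>\<close>.\<close>

lemma finite_index_sanov_automorphisms:
  "finite (rcosets\<^bsub>AutoGroup F3\<^esub> sanov_automorphisms)"
proof -
  interpret A: group "AutoGroup F3" by (rule group_AutoGroup_F3)
  define I where "I \<phi> = map (\<lambda>i. reduce_mod4 (cocycle_rep (\<phi> [(i, False)]))) [0..<3]"
    for \<phi> :: "nat letter list \<Rightarrow> nat letter list"
  show ?thesis
  proof (rule A.finite_rcosets_if_finite_invariant[OF subgroup_sanov_automorphisms, where I = I])
    let ?R = "{1, -1} \<times> {0..<4} \<times> {0..<4} :: (int \<times> int \<times> int) set"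
    have "reduce_mod4 (cocycle_rep (\<phi> [(i, False)])) \<in> ?R" if "\<phi> \<in> auto F3" "i < 3" for \<phi> i
    proof -
      have "cocycle_rep (\<phi> [(i, False)]) \<in> carrier twisted_plane"
        using auto_closed[OF that(1) F3_generator[OF that(2)]] cocycle_rep_hom
        by (auto simp: hom_def)
      then show ?thesis
        by (cases "cocycle_rep (\<phi> [(i, False)])") (auto simp: reduce_mod4_def)
    qed
    then have "I ` carrier (AutoGroup F3) \<subseteq> {xs. set xs \<subseteq> ?R \<and> length xs = 3}"
      by (fastforce simp: I_def AutoGroup_simps)
    moreover have "finite {xs. set xs \<subseteq> ?R \<and> length xs = 3}"
      by (rule finite_lists_length_eq) simp
    ultimately show "finite (I ` carrier (AutoGroup F3))"
      by (rule finite_subset)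
  next
    fix \<phi> \<psi> assume *: "\<phi> \<in> carrier (AutoGroup F3)" "\<psi> \<in> carrier (AutoGroup F3)" "I \<phi> = I \<psi>"
    define \<rho> where "\<rho> = \<phi> \<otimes>\<^bsub>AutoGroup F3\<^esub> inv\<^bsub>AutoGroup F3\<^esub> \<psi>"
    have \<phi>\<psi>: "\<phi> \<in> auto F3" "\<psi> \<in> auto F3"
      using * by (auto simp: AutoGroup_simps)
    note inv = AutoGroup_inv_apply[OF group_free_group \<phi>\<psi>(2)]
    have \<rho>: "\<rho> \<in> auto F3"
      using * A.m_closed A.inv_closed unfolding \<rho>_def by (simp add: AutoGroup_simps)
    have gen: "reduce_mod4 (cocycle_rep (\<phi> [(i, False)])) = reduce_mod4 (cocycle_rep (\<psi> [(i, False)]))"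
      if "i < 3" for i
      using *(3) that by (simp add: I_def)
    have red: "reduce_mod4 (cocycle_rep (\<rho> g)) = reduce_mod4 (cocycle_rep g)" if g: "g \<in> carrier F3" for g
    proof -
      have "reduce_mod4 (cocycle_rep (\<phi> ((inv\<^bsub>AutoGroup F3\<^esub> \<psi>) g))) =
          reduce_mod4 (cocycle_rep (\<psi> ((inv\<^bsub>AutoGroup F3\<^esub> \<psi>) g)))"
        by (rule cocycle_rep_cong_mod4[OF \<phi>\<psi> gen auto_closed[OF inv(1)[OF g] g]])
      then show ?thesis
        by (simp add: \<rho>_def AutoGroup_mult_apply \<phi>\<psi> inv[OF g] g)
    qed
    have stab: "\<rho> \<in> sign_stabilizer"
    proof (rule sign_stabilizerI[OF \<rho>])
      fix i :: nat assume "i < 3"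
      from arg_cong[OF red[OF F3_generator[OF this]], of fst]
      show "fst (cocycle_rep (\<rho> [(i, False)])) = fst (cocycle_rep [(i, False)])"
        by (simp add: reduce_mod4_def case_prod_beta)
    qed
    obtain a b c d where M: "cocycle_matrix \<rho> = (a, b, c, d)"
      by (cases "cocycle_matrix \<rho>")
    have "a mod 4 = 1" "b mod 4 = 0" "c mod 4 = 0" "d mod 4 = 1"
      using red[OF F3_generator[of 1 False]] red[OF F3_generator[of 2 False]] M
      by (auto simp: cocycle_matrix_def reduce_mod4_def cocycle_rep_generator split: prod.splits)
    then have entries: "4 dvd a - 1" "4 dvd b" "4 dvd c" "4 dvd d - 1"
      by (simp_all add: mod_eq_0_iff_dvd, presburger+)
    have "4 dvd a * (d - 1) + (a - 1) - b * c"
      using entries by (intro dvd_diff[OF dvd_add[OF dvd_mult] dvd_mult])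
    then have "4 dvd (a * d - b * c) - 1"
      by (simp add: algebra_simps)
    moreover have "a * d - b * c = 1 \<or> a * d - b * c = -1"
      using cocycle_matrix_hom stab M by (auto simp: hom_def Pi_iff)
    ultimately have "a * d - b * c = 1"
      by auto
    moreover have "2 dvd b" "2 dvd c"
      using entries by presburger+
    ultimately show "\<phi> \<otimes>\<^bsub>AutoGroup F3\<^esub> inv\<^bsub>AutoGroup F3\<^esub> \<psi> \<in> sanov_automorphisms"
      using stab M entries
      by (simp add: sanov_automorphisms_def sanov_group_def flip: \<rho>_def)
  qed
qed

section \<open>Realizing Sanov's generators by automorphisms\<close>

text \<open>The square of the Nielsen transvection \<open>x\<^sub>i \<mapsto> x\<^sub>i x\<^sub>j\<close>, or the inverse of the square if \<open>b\<close> holds.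
  Squares are needed for the even off-diagonal entries of Sanov's generators.\<close>

definition transvection :: "'a set \<Rightarrow> 'a \<Rightarrow> 'a \<Rightarrow> bool \<Rightarrow> 'a letter list \<Rightarrow> 'a letter list" where
  "transvection S i j b = free_lift (free_group S)
    (\<lambda>k. if k = i then [(i, False), (j, b), (j, b)] else [(k, False)])"

lemma transvection_hom:
  assumes "i \<in> S" "j \<in> S" "i \<noteq> j"
  shows "transvection S i j b \<in> hom (free_group S) (free_group S)"
  unfolding transvection_def using assms
  by (intro free_lift_hom[OF group_free_group])
    (auto simp: free_group_def reduced_word_def letter_inv_def)

lemma transvection_generator:
  assumes "i \<in> S" "j \<in> S" "i \<noteq> j" "k \<in> S"
  shows "transvection S i j b [(k, False)] =
    (if k = i then [(i, False), (j, b), (j, b)] else [(k, False)])"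
  unfolding transvection_def using assms
  by (subst free_lift_generator[OF group_free_group])
    (auto simp: free_group_def reduced_word_def letter_inv_def)

lemma transvection_inverse:
  assumes "i \<in> S" "j \<in> S" "i \<noteq> j" "w \<in> carrier (free_group S)"
  shows "transvection S i j (\<not> b) (transvection S i j b w) = w"
proof -
  have "(transvection S i j (\<not> b) \<circ> transvection S i j b) w = id w"
  proof (rule free_group_hom_eqI[OF group_free_group _ _ _ assms(4)])
    show "transvection S i j (\<not> b) \<circ> transvection S i j b \<in> hom (free_group S) (free_group S)"
      using transvection_hom[OF assms(1-3)] by (intro Group.hom_compose)
    show "id \<in> hom (free_group S) (free_group S)"
      by (simp add: hom_def)
    fix k assume k: "k \<in> S"
    have "transvection S i j (\<not> b) [(i, False), (j, b), (j, b)] = [(i, False)]"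
      using assms(1-3)
      by (simp add: transvection_def mult_free_group inv_letter_free_group letter_inv_def)
    then show "(transvection S i j (\<not> b) \<circ> transvection S i j b) [(k, False)] = id [(k, False)]"
      using transvection_generator[OF assms(1-3) k] by simp
  qed
  then show ?thesis
    by simp
qed

lemma transvection_auto:
  assumes "i \<in> S" "j \<in> S" "i \<noteq> j"
  shows "restrict (transvection S i j b) (carrier (free_group S)) \<in> auto (free_group S)"
  using transvection_hom[OF assms] transvection_inverse[OF assms, of _ b]
    transvection_inverse[OF assms, of _ "\<not> b"]
  by (intro restrict_in_auto[OF group_free_group, where g = "transvection S i j (\<not> b)"]) auto

lemma transvections_sanov:
  fixes i j :: nat
  assumes ij: "i = 1 \<and> j = 2 \<or> i = 2 \<and> j = 1"
  defines "\<tau> \<equiv> restrict (transvection {..<3} i j False) (carrier F3)"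
  shows "\<tau> \<in> sanov_automorphisms"
    and "cocycle_matrix \<tau> = (if i = 2 then (1, 2, 0, 1) else (1, 0, 2, 1))"
proof -
  have ij3: "i \<in> {..<3}" "j \<in> {..<3}" "i \<noteq> j"
    using ij by auto
  have \<tau>: "\<tau> \<in> auto F3"
    unfolding \<tau>_def by (rule transvection_auto[OF ij3])
  have gen: "\<tau> [(k, False)] = (if k = i then [(i, False), (j, False), (j, False)] else [(k, False)])"
    if "k < 3" for k
    using that transvection_generator[OF ij3] by (simp add: \<tau>_def F3_generator)
  have rep: "cocycle_rep [(i, False), (j, False), (j, False)] = (1, if i = 2 then 2 else 1, if i = 2 then 1 else 2)"
    using ij by (auto simp: cocycle_rep_def)
  show M: "cocycle_matrix \<tau> = (if i = 2 then (1, 2, 0, 1) else (1, 0, 2, 1))"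
    using ij rep by (auto simp: cocycle_matrix_def gen cocycle_rep_generator)
  have "\<tau> \<in> sign_stabilizer"
    by (rule sign_stabilizerI[OF \<tau>]) (use ij rep in \<open>auto simp: gen cocycle_rep_generator\<close>)
  then show "\<tau> \<in> sanov_automorphisms"
    using M by (auto simp: sanov_automorphisms_def sanov_group_def)
qed

text \<open>The generators of Sanov's group are the matrices of two transvections, so the map to matrices has a
  section over the free group, and the image of \<^const>\<open>sanov_automorphisms\<close> is all of that group.\<close>

theorem large_AutoGroup_F3: "large (AutoGroup F3)"
proof -
  interpret A: group "AutoGroup F3" by (rule group_AutoGroup_F3)
  let ?K = "(AutoGroup F3)\<lparr>carrier := sanov_automorphisms\<rparr>"
  let ?SL = "GL2Z\<lparr>carrier := sanov_group\<rparr>"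
  define \<alpha> where "\<alpha> = restrict (transvection {..<3::nat} 2 1 False) (carrier F3)"
  define \<beta> where "\<beta> = restrict (transvection {..<3::nat} 1 2 False) (carrier F3)"
  have \<alpha>: "\<alpha> \<in> sanov_automorphisms" "cocycle_matrix \<alpha> = (1, 2, 0, 1)"
    and \<beta>: "\<beta> \<in> sanov_automorphisms" "cocycle_matrix \<beta> = (1, 0, 2, 1)"
    unfolding \<alpha>_def \<beta>_def by (simp_all add: transvections_sanov)
  let ?F = "free_group {\<alpha>, \<beta>}"
  have K: "group ?K"
    by (rule A.subgroup_imp_group[OF subgroup_sanov_automorphisms])
  have M: "cocycle_matrix \<in> hom ?K ?SL"
    using cocycle_matrix_hom by (auto simp: hom_def sanov_automorphisms_def)
  \<comment> \<open>The free group is labelled by the two automorphisms themselves, so \<open>\<sigma>\<close> extends the identity.\<close>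
  define \<sigma> where "\<sigma> = free_lift ?K (\<lambda>s. s)"
  have \<sigma>: "\<sigma> \<in> hom ?F ?K"
    unfolding \<sigma>_def by (rule free_lift_hom[OF K]) (use \<alpha> \<beta> in auto)
  have \<sigma>_gen: "\<sigma> [(s, False)] = s" if "s \<in> {\<alpha>, \<beta>}" for s
    unfolding \<sigma>_def by (rule free_lift_generator[OF K _ that]) (use \<alpha> \<beta> in auto)
  have "cocycle_matrix \<circ> \<sigma> \<in> hom ?F GL2Z"
  proof -
    have "?SL\<lparr>carrier := carrier GL2Z\<rparr> = GL2Z"
      by simp
    moreover have "cocycle_matrix \<circ> \<sigma> \<in> hom ?F ?SL"
      by (rule Group.hom_compose[OF \<sigma> M])
    ultimately show ?thesis
      using subgroup.subset[OF subgroup_sanov_group] by (auto simp: hom_def Pi_iff)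
  qed
  then have iso: "cocycle_matrix \<circ> \<sigma> \<in> iso ?F ?SL"
    by (rule sanov_free) (use \<sigma>_gen \<alpha> \<beta> in auto)
  define f where "f = inv_into (carrier ?F) (cocycle_matrix \<circ> \<sigma>) \<circ> cocycle_matrix"
  have "inv_into (carrier ?F) (cocycle_matrix \<circ> \<sigma>) \<in> hom ?SL ?F"
    using group.iso_set_sym[OF group_free_group iso] by (simp add: iso_def)
  then have f: "f \<in> hom ?K ?F"
    unfolding f_def by (rule Group.hom_compose[OF M])
  have "f (\<sigma> w) = w" if "w \<in> carrier ?F" for w
  proof -
    have "inj_on (cocycle_matrix \<circ> \<sigma>) (carrier ?F)"
      using iso by (simp add: iso_def bij_betw_def)
    from inv_into_f_f[OF this that] show ?thesis
      by (simp add: f_def)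
  qed
  moreover have "\<sigma> w \<in> carrier ?K" if "w \<in> carrier ?F" for w
    using \<sigma> that by (auto simp: hom_def)
  ultimately have "carrier ?F \<subseteq> f ` carrier ?K"
    by (metis image_eqI subsetI)
  then have "f \<in> epi ?K ?F"
    using f by (auto simp: epi_def hom_def)
  moreover have "\<alpha> \<noteq> \<beta>"
    using \<alpha>(2) \<beta>(2) by auto
  then have "\<not> comm_group ?F"
    by (intro free_group_not_comm) auto
  ultimately show ?thesis
    unfolding large_def using subgroup_sanov_automorphisms finite_index_sanov_automorphisms by blast
qed

section \<open>Property (T) and finite-index subgroups with infinite cyclic quotients\<close>

text \<open>The representation induced from a unitary character \<open>c\<close> of a subgroup of finite index. It is realized
  on the functions \<open>\<xi>\<close> on \<open>G\<close> with \<open>\<xi> (k g) = c k * \<xi> g\<close> for \<open>k\<close> in \<open>K\<close>, on which \<open>G\<close> acts by right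
  translation. Such a function is determined by its values on a transversal, so the space has finite
  dimension.\<close>

locale finite_index_character = group G + subgroup K G
  for G :: "('g, 'm) monoid_scheme" (structure) and K :: "'g set" +
  fixes c :: "'g \<Rightarrow> complex"
  assumes finite_index: "finite (rcosets K)"
    and c_mult: "\<lbrakk>k \<in> K; l \<in> K\<rbrakk> \<Longrightarrow> c (k \<otimes> l) = c k * c l"
    and norm_c: "k \<in> K \<Longrightarrow> norm (c k) = 1"
begin

definition rep :: "'g \<Rightarrow> 'g" where
  "rep g = (SOME h. h \<in> K #> g)"

definition transversal :: "'g set" where
  "transversal = rep ` carrier G"

text \<open>A function on \<open>G\<close> is encoded as a function supported on \<open>carrier G \<times> {0}\<close>, because
  \<^const>\<open>property_T\<close> ranges over spaces of functions on \<^typ>\<open>'g \<times> nat\<close>.\<close>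

definition equivariant :: "('g \<times> nat \<Rightarrow> complex) set" where
  "equivariant =
    {\<xi>. (\<forall>k\<in>K. \<forall>g\<in>carrier G. \<xi> (k \<otimes> g, 0) = c k * \<xi> (g, 0)) \<and>
      (\<forall>g i. g \<notin> carrier G \<or> i \<noteq> 0 \<longrightarrow> \<xi> (g, i) = 0)}"

definition induced_space :: "('g \<times> nat \<Rightarrow> complex) hilbert" where
  "induced_space =
    \<lparr>carrier = equivariant, mult = (\<lambda>_ _. undefined), one = undefined,
     ring.zero = (\<lambda>_. 0), add = (\<lambda>\<xi> \<eta> x. \<xi> x + \<eta> x), smult = (\<lambda>a \<xi> x. a * \<xi> x),
     cinner = (\<lambda>\<xi> \<eta>. \<Sum>t\<in>transversal. \<xi> (t, 0) * cnj (\<eta> (t, 0)))\<rparr>"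

definition translate :: "'g \<Rightarrow> ('g \<times> nat \<Rightarrow> complex) \<Rightarrow> 'g \<times> nat \<Rightarrow> complex" where
  "translate g \<xi> = (\<lambda>(h, i). if h \<in> carrier G \<and> i = 0 then \<xi> (h \<otimes> g, 0) else 0)"

definition induced_rep :: "'g \<Rightarrow> ('g \<times> nat \<Rightarrow> complex) \<Rightarrow> 'g \<times> nat \<Rightarrow> complex" where
  "induced_rep g = restrict (translate g) equivariant"

lemma induced_space_simps [simp]:
  "carrier induced_space = equivariant"
  "\<zero>\<^bsub>induced_space\<^esub> = (\<lambda>_. 0)"
  "\<xi> \<oplus>\<^bsub>induced_space\<^esub> \<eta> = (\<lambda>x. \<xi> x + \<eta> x)"
  "a \<odot>\<^bsub>induced_space\<^esub> \<xi> = (\<lambda>x. a * \<xi> x)"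
  "cinner induced_space \<xi> \<eta> = (\<Sum>t\<in>transversal. \<xi> (t, 0) * cnj (\<eta> (t, 0)))"
  by (simp_all add: induced_space_def)

lemma equivariantD:
  assumes "\<xi> \<in> equivariant"
  shows "\<lbrakk>k \<in> K; g \<in> carrier G\<rbrakk> \<Longrightarrow> \<xi> (k \<otimes> g, 0) = c k * \<xi> (g, 0)"
    and "g \<notin> carrier G \<or> i \<noteq> 0 \<Longrightarrow> \<xi> (g, i) = 0"
  using assms by (auto simp: equivariant_def)

lemma rep:
  assumes "g \<in> carrier G"
  shows rep_in_coset: "rep g \<in> K #> g"
    and rep_closed: "rep g \<in> carrier G"
    and coset_rep: "K #> rep g = K #> g"
    and rep_quotient: "g \<otimes> inv (rep g) \<in> K"
proof -
  have sub: "subgroup K G" ..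
  show mem: "rep g \<in> K #> g"
    unfolding rep_def using rcos_self[OF assms sub] by (rule someI)
  then show closed: "rep g \<in> carrier G"
    using r_coset_subset_G[OF subset assms] by blast
  show eq: "K #> rep g = K #> g"
    using repr_independence[OF mem assms sub] by simp
  have "g \<in> K #> rep g"
    using rcos_self[OF assms sub] eq by simp
  then show "g \<otimes> inv (rep g) \<in> K"
    using rcos_module[OF is_group closed assms] by simp
qed

lemma rep_cong: "K #> g = K #> h \<Longrightarrow> rep g = rep h"
  by (simp add: rep_def)

lemma rep_rep: "g \<in> carrier G \<Longrightarrow> rep (rep g) = rep g"
  by (rule rep_cong) (rule coset_rep)

lemma rep_mult: "k \<in> K \<Longrightarrow> g \<in> carrier G \<Longrightarrow> rep (k \<otimes> g) = rep g"
  by (rule rep_cong)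
    (metis coset_join2 coset_mult_assoc is_group mem_carrier subgroup_axioms subset)

lemma rep_mult_right:
  assumes "g \<in> carrier G" "h \<in> carrier G"
  shows "rep (rep g \<otimes> h) = rep (g \<otimes> h)"
proof (rule rep_cong)
  show "K #> (rep g \<otimes> h) = K #> (g \<otimes> h)"
    using assms rep_closed coset_rep subset by (metis coset_mult_assoc)
qed

lemma transversal_closed: "t \<in> transversal \<Longrightarrow> t \<in> carrier G"
  by (auto simp: transversal_def rep_closed)

lemma rep_transversal: "t \<in> transversal \<Longrightarrow> rep t = t"
  by (auto simp: transversal_def rep_rep)

lemma finite_transversal: "finite transversal"
proof -
  have "transversal = (\<lambda>C. SOME h. h \<in> C) ` (rcosets K)"
    by (auto simp: transversal_def rep_def RCOSETS_def)
  then show ?thesis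
    using finite_index by simp
qed

lemma transversal_nonempty: "transversal \<noteq> {}"
  by (auto simp: transversal_def)

text \<open>Right translation permutes the cosets, hence the transversal up to representatives.\<close>

lemma bij_betw_translate_transversal:
  assumes "g \<in> carrier G"
  shows "bij_betw (\<lambda>t. rep (t \<otimes> g)) transversal transversal"
proof (rule bij_betw_byWitness[where f' = "\<lambda>t. rep (t \<otimes> inv g)"])
  have "rep (rep (t \<otimes> g) \<otimes> inv g) = t" if "t \<in> transversal" "g \<in> carrier G" for t g
    using that by (simp add: rep_mult_right transversal_closed m_assoc rep_transversal)
  from this[OF _ assms] this[OF _ inv_closed[OF assms]]
  show "\<forall>t\<in>transversal. rep (rep (t \<otimes> g) \<otimes> inv g) = t"
    and "\<forall>t\<in>transversal. rep (rep (t \<otimes> inv g) \<otimes> g) = t"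
    using assms by auto
qed (use assms in \<open>auto simp: transversal_closed, auto simp: transversal_def rep_closed\<close>)

lemma equivariant_rep:
  assumes "\<xi> \<in> equivariant" "g \<in> carrier G"
  shows "\<xi> (g, 0) = c (g \<otimes> inv (rep g)) * \<xi> (rep g, 0)"
proof -
  have "g \<otimes> inv (rep g) \<otimes> rep g = g"
    using assms(2) by (simp add: m_assoc rep_closed)
  then show ?thesis
    using equivariantD(1)[OF assms(1) rep_quotient[OF assms(2)] rep_closed[OF assms(2)]] by simp
qed

lemma norm_equivariant_rep:
  assumes "\<xi> \<in> equivariant" "g \<in> carrier G"
  shows "norm (\<xi> (g, 0)) = norm (\<xi> (rep g, 0))"
  using equivariant_rep[OF assms] norm_c[OF rep_quotient[OF assms(2)]] by (simp add: norm_mult)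

lemma equivariant_arith:
  shows "(\<lambda>_. 0) \<in> equivariant"
    and "\<lbrakk>\<xi> \<in> equivariant; \<eta> \<in> equivariant\<rbrakk> \<Longrightarrow> (\<lambda>x. \<xi> x + \<eta> x) \<in> equivariant"
    and "\<xi> \<in> equivariant \<Longrightarrow> (\<lambda>x. a * \<xi> x) \<in> equivariant"
    and "\<lbrakk>\<xi> \<in> equivariant; \<eta> \<in> equivariant\<rbrakk> \<Longrightarrow> (\<lambda>x. \<xi> x - \<eta> x) \<in> equivariant"
  by (auto simp: equivariant_def algebra_simps)

lemma module_induced_space: "module complex_ring induced_space"
proof (rule moduleI[OF cring_complex_ring])
  show "abelian_group induced_space"
  proof (rule abelian_groupI)
    fix \<xi> assume "\<xi> \<in> carrier induced_space"
    then show "\<exists>\<eta>\<in>carrier induced_space. \<eta> \<oplus>\<^bsub>induced_space\<^esub> \<xi> = \<zero>\<^bsub>induced_space\<^esub>"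
      using equivariant_arith(3)[of \<xi> "-1"] by (intro bexI[of _ "\<lambda>x. -1 * \<xi> x"]) auto
  qed (auto simp: equivariant_arith algebra_simps)
qed (auto simp: complex_ring_def equivariant_arith algebra_simps)

lemma minus_induced_space:
  assumes "\<xi> \<in> equivariant" "\<eta> \<in> equivariant"
  shows "\<xi> \<ominus>\<^bsub>induced_space\<^esub> \<eta> = (\<lambda>x. \<xi> x - \<eta> x)"
proof -
  interpret module complex_ring induced_space by (rule module_induced_space)
  have "\<ominus>\<^bsub>induced_space\<^esub> \<eta> = (\<lambda>x. -1 * \<eta> x)"
    using assms equivariant_arith(3)[of \<eta> "-1"] by (intro M.minus_equality) auto
  then show ?thesis
    by (simp add: a_minus_def)
qed

lemma hnorm_induced_space:
  "hnorm induced_space \<xi> = L2_set (\<lambda>t. norm (\<xi> (t, 0))) transversal"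
  by (simp add: hnorm_def L2_set_def complex_mult_cnj cmod_power2 complex_norm_square [symmetric] flip: of_real_power)

lemma hdist_induced_space:
  assumes "\<xi> \<in> equivariant" "\<eta> \<in> equivariant"
  shows "hdist induced_space \<xi> \<eta> = L2_set (\<lambda>t. norm (\<xi> (t, 0) - \<eta> (t, 0))) transversal"
  using assms by (simp add: hdist_def hnorm_induced_space minus_induced_space)

lemma equivariant_eqI:
  assumes "\<xi> \<in> equivariant" "\<eta> \<in> equivariant"
    and "\<And>t. t \<in> transversal \<Longrightarrow> \<xi> (t, 0) = \<eta> (t, 0)"
  shows "\<xi> = \<eta>"
proof
  fix x :: "'g \<times> nat"
  obtain g i where x: "x = (g, i)" by (cases x)
  show "\<xi> x = \<eta> x"
  proof (cases "g \<in> carrier G \<and> i = 0")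
    case True
    then have "rep g \<in> transversal"
      by (simp add: transversal_def)
    then show ?thesis
      using True x assms equivariant_rep[of \<xi> g] equivariant_rep[of \<eta> g] by simp
  next
    case False
    then show ?thesis
      using x equivariantD(2)[OF assms(1), of g i] equivariantD(2)[OF assms(2), of g i] by auto
  qed
qed

lemma Metric_space_induced_space: "Metric_space equivariant (hdist induced_space)"
proof
  fix \<xi> \<eta>
  show "0 \<le> hdist induced_space \<xi> \<eta>"
    by (simp add: hdist_def hnorm_induced_space)
  show "hdist induced_space \<xi> \<eta> = hdist induced_space \<eta> \<xi>"
    by (cases "\<xi> \<in> equivariant \<and> \<eta> \<in> equivariant")
      (auto simp: hdist_induced_space norm_minus_commute, auto simp: hdist_def)
next
  fix \<xi> \<eta> assume "\<xi> \<in> equivariant" "\<eta> \<in> equivariant"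
  then show "hdist induced_space \<xi> \<eta> = 0 \<longleftrightarrow> \<xi> = \<eta>"
    using equivariant_eqI[of \<xi> \<eta>]
    by (auto simp: hdist_induced_space L2_set_eq_0_iff finite_transversal)
next
  fix \<xi> \<eta> \<zeta> assume *: "\<xi> \<in> equivariant" "\<eta> \<in> equivariant" "\<zeta> \<in> equivariant"
  have "L2_set (\<lambda>t. norm (\<xi> (t, 0) - \<zeta> (t, 0))) transversal \<le>
      L2_set (\<lambda>t. norm (\<xi> (t, 0) - \<eta> (t, 0)) + norm (\<eta> (t, 0) - \<zeta> (t, 0))) transversal"
    by (rule L2_set_mono) (auto intro: norm_diff_triangle_le)
  also have "\<dots> \<le> L2_set (\<lambda>t. norm (\<xi> (t, 0) - \<eta> (t, 0))) transversal +
      L2_set (\<lambda>t. norm (\<eta> (t, 0) - \<zeta> (t, 0))) transversal"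
    by (rule L2_set_triangle_ineq)
  finally show "hdist induced_space \<xi> \<zeta> \<le> hdist induced_space \<xi> \<eta> + hdist induced_space \<eta> \<zeta>"
    using * by (simp add: hdist_induced_space)
qed

lemma mcomplete_induced_space: "Metric_space.mcomplete equivariant (hdist induced_space)"
proof -
  interpret M: Metric_space equivariant "hdist induced_space"
    by (rule Metric_space_induced_space)
  have "\<exists>\<xi>. limitin M.mtopology \<sigma> \<xi> sequentially" if "M.MCauchy \<sigma>" for \<sigma>
  proof -
    have \<sigma>: "\<sigma> n \<in> equivariant" for n
      using that by (auto simp: M.MCauchy_def)
    \<comment> \<open>The value at a point is bounded by the one at its representative, so a Cauchy sequence
      converges pointwise.\<close>
    have bound: "norm (\<sigma> m x - \<sigma> n x) \<le> hdist induced_space (\<sigma> m) (\<sigma> n)" for m n x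
    proof -
      obtain g i where x: "x = (g, i)" by (cases x)
      show ?thesis
      proof (cases "g \<in> carrier G \<and> i = 0")
        case True
        then have "norm (\<sigma> m x - \<sigma> n x) = norm (\<sigma> m (rep g, 0) - \<sigma> n (rep g, 0))"
          using norm_equivariant_rep[OF equivariant_arith(4)[OF \<sigma>[of m] \<sigma>[of n]], of g] x by simp
        also have "\<dots> \<le> hdist induced_space (\<sigma> m) (\<sigma> n)"
          using True unfolding hdist_induced_space[OF \<sigma> \<sigma>]
          by (intro member_le_L2_set[OF finite_transversal,
                where f = "\<lambda>t. norm (\<sigma> m (t, 0) - \<sigma> n (t, 0))"])
            (simp_all add: transversal_def)
        finally show ?thesis .
      next
        case False
        then show ?thesis
          using x equivariantD(2)[OF \<sigma>, of g i] by auto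
      qed
    qed
    have "Cauchy (\<lambda>n. \<sigma> n x)" for x
      unfolding Cauchy_def dist_norm
    proof (intro allI impI)
      fix e :: real assume "0 < e"
      then obtain N where "\<forall>m n. N \<le> m \<longrightarrow> N \<le> n \<longrightarrow> hdist induced_space (\<sigma> m) (\<sigma> n) < e"
        using \<open>M.MCauchy \<sigma>\<close> unfolding M.MCauchy_def by meson
      then show "\<exists>N. \<forall>m\<ge>N. \<forall>n\<ge>N. norm (\<sigma> m x - \<sigma> n x) < e"
        using bound by (meson le_less_trans)
    qed
    then have lim: "(\<lambda>n. \<sigma> n x) \<longlonglongrightarrow> lim (\<lambda>n. \<sigma> n x)" for x
      by (simp add: Cauchy_convergent convergent_LIMSEQ_iff [symmetric])
    define \<xi> where "\<xi> x = lim (\<lambda>n. \<sigma> n x)" for x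
    have lim: "(\<lambda>n. \<sigma> n x) \<longlonglongrightarrow> \<xi> x" for x
      using lim by (simp add: \<xi>_def)
    have \<xi>: "\<xi> \<in> equivariant"
      unfolding equivariant_def
    proof (intro CollectI conjI ballI allI impI)
      fix k g assume kg: "k \<in> K" "g \<in> carrier G"
      have "(\<lambda>n. c k * \<sigma> n (g, 0)) \<longlonglongrightarrow> c k * \<xi> (g, 0)"
        by (intro tendsto_intros lim)
      then show "\<xi> (k \<otimes> g, 0) = c k * \<xi> (g, 0)"
        using lim[of "(k \<otimes> g, 0)"] by (auto simp: equivariantD(1)[OF \<sigma> kg] intro: LIMSEQ_unique)
    next
      fix g i assume "g \<notin> carrier G \<or> i \<noteq> (0::nat)"
      then show "\<xi> (g, i) = 0"
        using lim[of "(g, i)"] by (simp add: equivariantD(2)[OF \<sigma>] LIMSEQ_const_iff)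
    qed
    have "(\<lambda>n. L2_set (\<lambda>t. norm (\<sigma> n (t, 0) - \<xi> (t, 0))) transversal) \<longlonglongrightarrow>
        L2_set (\<lambda>t. norm (\<xi> (t, 0) - \<xi> (t, 0))) transversal"
      unfolding L2_set_def by (intro tendsto_intros lim)
    then have "(\<lambda>n. hdist induced_space (\<sigma> n) \<xi>) \<longlonglongrightarrow> 0"
      by (simp add: hdist_induced_space \<sigma> \<xi> L2_set_def)
    then show ?thesis
      using \<xi> \<sigma> by (auto simp: M.limitin_metric_dist_null)
  qed
  then show ?thesis
    by (simp add: M.mcomplete_def)
qed

lemma hilbert_space_induced_space: "hilbert_space induced_space"
proof (intro hilbert_space.intro hilbert_space_axioms.intro)
  show "module complex_ring induced_space"
    by (rule module_induced_space)
  show "Metric_space.mcomplete (carrier induced_space) (hdist induced_space)"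
    by (simp add: mcomplete_induced_space)
next
  fix \<xi> assume \<xi>: "\<xi> \<in> carrier induced_space" "\<xi> \<noteq> \<zero>\<^bsub>induced_space\<^esub>"
  then obtain t where t: "t \<in> transversal" "\<xi> (t, 0) \<noteq> 0"
    using equivariant_eqI[of \<xi> "\<lambda>_. 0"] equivariant_arith(1) by auto
  have "0 < (\<Sum>t\<in>transversal. (norm (\<xi> (t, 0)))\<^sup>2)"
    using t by (intro sum_pos2[OF finite_transversal, of t]) auto
  then show "0 < Re (cinner induced_space \<xi> \<xi>)"
    by (simp add: complex_norm_square [symmetric] flip: of_real_power)
qed (auto simp: sum_distrib_left sum.distrib algebra_simps)

lemma translate_closed:
  assumes "g \<in> carrier G" "\<xi> \<in> equivariant"
  shows "translate g \<xi> \<in> equivariant"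
  using assms by (auto simp: equivariant_def translate_def m_assoc)

lemma translate_mult:
  assumes "g \<in> carrier G" "h \<in> carrier G"
  shows "translate (g \<otimes> h) \<xi> = translate g (translate h \<xi>)"
  using assms by (auto simp: translate_def m_assoc fun_eq_iff)

lemma translate_one:
  assumes "\<xi> \<in> equivariant"
  shows "translate \<one> \<xi> = \<xi>"
  using assms by (auto simp: translate_def equivariantD(2) fun_eq_iff)

text \<open>Translation by \<open>g\<close> replaces \<open>t\<close> by \<open>t \<otimes> g\<close>, whose representative differs from it by an element of
  \<open>K\<close>. The values of the two functions there change by the same factor of modulus \<open>1\<close>, which cancels.\<close>

lemma cinner_translate:
  assumes "g \<in> carrier G" "\<xi> \<in> equivariant" "\<eta> \<in> equivariant"
  shows "cinner induced_space (translate g \<xi>) (translate g \<eta>) = cinner induced_space \<xi> \<eta>"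
proof -
  have "cinner induced_space (translate g \<xi>) (translate g \<eta>) =
      (\<Sum>t\<in>transversal. \<xi> (t \<otimes> g, 0) * cnj (\<eta> (t \<otimes> g, 0)))"
    by (simp add: translate_def transversal_closed)
  also have "\<dots> = (\<Sum>t\<in>transversal. \<xi> (rep (t \<otimes> g), 0) * cnj (\<eta> (rep (t \<otimes> g), 0)))"
  proof (rule sum.cong[OF refl])
    fix t assume "t \<in> transversal"
    then have tg: "t \<otimes> g \<in> carrier G"
      using assms(1) transversal_closed by simp
    let ?k = "t \<otimes> g \<otimes> inv (rep (t \<otimes> g))"
    have "c ?k * cnj (c ?k) = 1"
      using norm_c[OF rep_quotient[OF tg]] by (simp add: complex_norm_square [symmetric])
    moreover have "\<xi> (t \<otimes> g, 0) * cnj (\<eta> (t \<otimes> g, 0)) =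
        (c ?k * cnj (c ?k)) * (\<xi> (rep (t \<otimes> g), 0) * cnj (\<eta> (rep (t \<otimes> g), 0)))"
      using equivariant_rep[OF assms(2) tg] equivariant_rep[OF assms(3) tg] by simp
    ultimately show "\<xi> (t \<otimes> g, 0) * cnj (\<eta> (t \<otimes> g, 0)) =
        \<xi> (rep (t \<otimes> g), 0) * cnj (\<eta> (rep (t \<otimes> g), 0))"
      by simp
  qed
  also have "\<dots> = cinner induced_space \<xi> \<eta>"
    using sum.reindex_bij_betw[OF bij_betw_translate_transversal[OF assms(1)],
        where g = "\<lambda>t. \<xi> (t, 0) * cnj (\<eta> (t, 0))"] by simp
  finally show ?thesis .
qed

lemma unitary_rep_induced_rep: "unitary_rep G induced_space induced_rep"
proof -
  have Bij: "induced_rep g \<in> Bij equivariant" if "g \<in> carrier G" for g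
  proof -
    have "translate (inv g) (translate g \<xi>) = \<xi>" "translate g (translate (inv g) \<xi>) = \<xi>"
      if "\<xi> \<in> equivariant" for \<xi>
      using \<open>g \<in> carrier G\<close> that
      by (simp_all add: translate_mult [symmetric] translate_one)
    then have "bij_betw (translate g) equivariant equivariant"
      using that
      by (intro bij_betw_byWitness[where f' = "translate (inv g)"]) (auto simp: translate_closed)
    then show ?thesis
      unfolding induced_rep_def Bij_def by (simp cong: bij_betw_cong)
  qed
  have "induced_rep g \<in> unitary_operators induced_space" if "g \<in> carrier G" for g
    using that Bij[OF that] cinner_translate[OF that] equivariant_arith
    by (auto simp: unitary_operators_def induced_rep_def translate_def fun_eq_iff simp del: induced_space_simps(5))
  moreover have "induced_rep (g \<otimes> h) = compose equivariant (induced_rep g) (induced_rep h)"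
    if "g \<in> carrier G" "h \<in> carrier G" for g h
    using that by (auto simp: induced_rep_def compose_def translate_mult translate_closed fun_eq_iff)
  ultimately show ?thesis
    using Bij hilbert_space_induced_space
    by (auto simp: unitary_rep_def hom_def unitary_group_def BijGroup_def)
qed

text \<open>An invariant vector is constant, and equivariance multiplies the constant by the values of
  \<open>c\<close>.\<close>

lemma no_invariant_vector:
  assumes k: "k \<in> K" "c k \<noteq> 1"
  shows "\<not> has_invariant_vector G induced_space induced_rep"
proof
  assume "has_invariant_vector G induced_space induced_rep"
  then obtain \<xi> where \<xi>: "\<xi> \<in> equivariant" "\<xi> \<noteq> (\<lambda>_. 0)"
    and inv: "\<And>g. g \<in> carrier G \<Longrightarrow> translate g \<xi> = \<xi>"
    by (auto simp: has_invariant_vector_def induced_rep_def)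
  have const: "\<xi> (g, 0) = \<xi> (\<one>, 0)" if "g \<in> carrier G" for g
    using fun_cong[OF inv[OF that], of "(\<one>, 0)"] that by (simp add: translate_def)
  have "c k * \<xi> (\<one>, 0) = \<xi> (\<one>, 0)"
    using equivariantD(1)[OF \<xi>(1) k(1), of \<one>] const[of k] k(1) by simp
  then have "\<xi> (\<one>, 0) = 0"
    using k(2) by simp
  then have "\<xi> = (\<lambda>_. 0)"
    using equivariantD(2)[OF \<xi>(1)] const by (metis ext surj_pair)
  then show False
    using \<xi>(2) by simp
qed

text \<open>Take the vector that is \<open>1\<close> on the transversal. At \<open>t\<close>, it is moved by \<open>q\<close> as far as \<open>c\<close> is from
  \<open>1\<close> at the element of \<open>K\<close> that compares \<open>t \<otimes> q\<close> with its representative.\<close>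

lemma almost_invariant_vector:
  assumes "Q \<subseteq> carrier G" "0 \<le> \<delta>" "\<delta> < \<epsilon>"
    and close: "\<And>q t. \<lbrakk>q \<in> Q; t \<in> transversal\<rbrakk> \<Longrightarrow> norm (c (t \<otimes> q \<otimes> inv (rep (t \<otimes> q))) - 1) \<le> \<delta>"
  shows "has_almost_invariant_vector induced_space induced_rep Q \<epsilon>"
proof -
  define \<xi> :: "'g \<times> nat \<Rightarrow> complex"
    where "\<xi> = (\<lambda>(g, i). if g \<in> carrier G \<and> i = 0 then c (g \<otimes> inv (rep g)) else 0)"
  have \<xi>: "\<xi> \<in> equivariant"
  proof -
    have "c (k \<otimes> g \<otimes> inv (rep (k \<otimes> g))) = c k * c (g \<otimes> inv (rep g))"
      if "k \<in> K" "g \<in> carrier G" for k g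
      using that c_mult[OF that(1) rep_quotient[OF that(2)]]
      by (simp add: rep_mult m_assoc rep_closed)
    then show ?thesis
      by (auto simp: equivariant_def \<xi>_def)
  qed
  have c_one: "c \<one> = 1"
    using c_mult[OF one_closed one_closed] norm_c[OF one_closed] by auto
  have \<xi>_transversal: "\<xi> (t, 0) = 1" if "t \<in> transversal" for t
    using that by (simp add: \<xi>_def transversal_closed rep_transversal c_one)
  have norm: "hnorm induced_space \<xi> = sqrt (card transversal)"
    by (simp add: hnorm_induced_space L2_set_def \<xi>_transversal)
  have pos: "0 < sqrt (card transversal)"
    using finite_transversal transversal_nonempty by (simp add: card_gt_0_iff)
  have "hnorm induced_space (induced_rep q \<xi> \<ominus>\<^bsub>induced_space\<^esub> \<xi>) < \<epsilon> * hnorm induced_space \<xi>"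
    if q: "q \<in> Q" for q
  proof -
    have qG: "q \<in> carrier G"
      using q assms(1) by blast
    have "hnorm induced_space (induced_rep q \<xi> \<ominus>\<^bsub>induced_space\<^esub> \<xi>) =
        L2_set (\<lambda>t. norm (c (t \<otimes> q \<otimes> inv (rep (t \<otimes> q))) - 1)) transversal"
      using \<xi> qG translate_closed[OF qG \<xi>]
      by (simp add: minus_induced_space induced_rep_def hnorm_induced_space translate_def \<xi>_transversal
          transversal_closed cong: L2_set_cong) (simp add: \<xi>_def transversal_closed cong: L2_set_cong)
    also have "\<dots> \<le> L2_set (\<lambda>_. \<delta>) transversal"
      using close[OF q] by (intro L2_set_mono) auto
    also have "\<dots> = \<delta> * sqrt (card transversal)"
      using assms(2) by (simp add: L2_set_def real_sqrt_mult mult.commute)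
    also have "\<dots> < \<epsilon> * sqrt (card transversal)"
      using assms(3) pos by simp
    finally show ?thesis
      by (simp add: norm)
  qed
  moreover have "\<xi> \<noteq> (\<lambda>_. 0)"
    using \<xi>_transversal transversal_nonempty by (metis ex_in_conv zero_neq_one)
  ultimately show ?thesis
    using \<xi> by (auto simp: has_almost_invariant_vector_def)
qed

end

text \<open>Composing the homomorphism with \<open>m \<mapsto> cis (\<theta> * m)\<close> gives characters of \<open>K\<close>. As the angle \<open>\<theta>\<close> tends
  to \<open>0\<close>, they tend to the trivial character, and the induced representations acquire vectors that are
  invariant up to any given error. None of them has an invariant vector, as long as the character is
  not trivial.\<close>

theorem not_property_T_if_nontrivial_hom_to_integers:
  fixes G :: "('g, 'm) monoid_scheme" (structure)
  assumes G: "group G" and K: "subgroup K G" and index: "finite (rcosets K)"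
    and n: "n \<in> hom (G\<lparr>carrier := K\<rparr>) integer_group" and k0: "k0 \<in> K" "n k0 \<noteq> 0"
  shows "\<not> property_T G"
proof
  assume "property_T G"
  then obtain Q \<epsilon> where Q: "finite Q" "Q \<subseteq> carrier G" and \<epsilon>: "0 < \<epsilon>"
    and T: "\<And>(H :: ('g \<times> nat \<Rightarrow> complex) hilbert) \<pi>. \<lbrakk>unitary_rep G H \<pi>;
        has_almost_invariant_vector H \<pi> Q \<epsilon>\<rbrakk> \<Longrightarrow> has_invariant_vector G H \<pi>"
    unfolding property_T_def by blast
  interpret group G by fact
  have character: "finite_index_character G K (\<lambda>k. cis (\<theta> * n k))" for \<theta> :: real
    using n by (intro finite_index_character.intro finite_index_character_axioms.intro G K index)
      (auto simp: hom_def integer_group_def cis_mult algebra_simps)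
  \<comment> \<open>The representatives do not depend on the angle. The character with angle \<open>0\<close> makes them available
    before \<open>\<theta>\<close> is chosen.\<close>
  interpret trivial: finite_index_character G K "\<lambda>k. cis ((0::real) * n k)"
    by (rule character)
  define D where "D = insert k0 ((\<lambda>(q, t). t \<otimes> q \<otimes> inv (trivial.rep (t \<otimes> q))) ` (Q \<times> trivial.transversal))"
  have "finite D"
    using Q(1) trivial.finite_transversal by (simp add: D_def)
  then have "bdd_above ((\<lambda>k. \<bar>real_of_int (n k)\<bar>) ` D)"
    by (intro bdd_above_finite finite_imageI)
  then obtain B where B: "\<And>k. k \<in> D \<Longrightarrow> \<bar>real_of_int (n k)\<bar> \<le> B"
    unfolding bdd_above_def by blast
  \<comment> \<open>Angles up to \<open>1\<close> are smaller than \<open>pi\<close>, so that the character stays nontrivial at \<open>k0\<close>.\<close>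
  define \<delta> where "\<delta> = min 1 (\<epsilon> / 2)"
  define \<theta> where "\<theta> = \<delta> / B"
  have "0 < B"
    using B[of k0] k0(2) by (simp add: D_def)
  have \<delta>: "0 < \<delta>" "\<delta> \<le> 1" "\<delta> < \<epsilon>"
    using \<epsilon> by (auto simp: \<delta>_def)
  have angle: "\<bar>\<theta> * n k\<bar> \<le> \<delta>" if "k \<in> D" for k
    using B[OF that] \<open>0 < B\<close> \<delta>(1) by (simp add: \<theta>_def abs_mult field_simps)
  interpret finite_index_character G K "\<lambda>k. cis (\<theta> * n k)"
    by (rule character)
  have "has_almost_invariant_vector induced_space induced_rep Q \<epsilon>"
  proof (rule almost_invariant_vector[OF Q(2) _ \<delta>(3)])
    fix q t assume "q \<in> Q" "t \<in> transversal"
    then have "t \<otimes> q \<otimes> inv (rep (t \<otimes> q)) \<in> D"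
      by (auto simp: D_def)
    from angle[OF this] show "norm (cis (\<theta> * n (t \<otimes> q \<otimes> inv (rep (t \<otimes> q)))) - 1) \<le> \<delta>"
      using dist_exp_i_1[of "\<theta> * n (t \<otimes> q \<otimes> inv (rep (t \<otimes> q)))"]
        abs_sin_x_le_abs_x[of "\<theta> * n (t \<otimes> q \<otimes> inv (rep (t \<otimes> q))) / 2"]
      by (simp add: cis_conv_exp)
  qed (use \<delta> in simp)
  then have "has_invariant_vector G induced_space induced_rep"
    using T unitary_rep_induced_rep by blast
  moreover have "cis (\<theta> * n k0) \<noteq> 1"
  proof
    assume "cis (\<theta> * n k0) = 1"
    then have "sin \<bar>\<theta> * n k0\<bar> = 0"
      by (simp add: complex_eq_iff abs_if)
    moreover have "0 < \<bar>\<theta> * n k0\<bar>" "\<bar>\<theta> * n k0\<bar> < pi"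
      using angle[of k0] k0(2) \<delta> \<open>0 < B\<close> pi_gt3 by (auto simp: D_def \<theta>_def)
    ultimately show False
      using sin_gt_zero[of "\<bar>\<theta> * n k0\<bar>"] by simp
  qed
  ultimately show False
    using no_invariant_vector[OF k0(1)] by blast
qed

text \<open>A free group that is not commutative has a generator, and counting the exponent of that
  generator maps it onto the integers.\<close>

theorem large_not_property_T:
  fixes G :: "('g, 'm) monoid_scheme" (structure)
  assumes "group G" "large G"
  shows "\<not> property_T G"
proof -
  obtain K and S :: "'g set" and f where K: "subgroup K G" "finite (rcosets K)"
    and S: "\<not> comm_group (free_group S)" and f: "f \<in> epi (G\<lparr>carrier := K\<rparr>) (free_group S)"
    using assms(2) unfolding large_def by blast
  have Z: "group integer_group"
    by simp
  have "S \<noteq> {}"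
  proof
    assume "S = {}"
    then have "carrier (free_group S) = {[]}"
      by (auto simp: free_group_def reduced_word_def)
    then have "comm_group (free_group S)"
      using group.group_comm_groupI[OF group_free_group, of S] by simp
    then show False
      using S by simp
  qed
  then obtain s where s: "s \<in> S" by blast
  define e where "e = free_lift integer_group (\<lambda>s'. if s' = s then 1 else 0)"
  have e: "e \<in> hom (free_group S) integer_group" "e [(s, False)] = 1"
    unfolding e_def using free_lift_hom[OF Z] free_lift_generator[OF Z _ s]
    by (auto simp: integer_group_def)
  obtain k where k: "k \<in> K" "f k = [(s, False)]"
    using f letter_in_free_group[of "(s, False)" S] s unfolding epi_def by force
  have "e \<circ> f \<in> hom (G\<lparr>carrier := K\<rparr>) integer_group"
    using f e(1) by (auto simp: epi_def intro: Group.hom_compose)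
  from not_property_T_if_nontrivial_hom_to_integers[OF assms(1) K this k(1)] show ?thesis
    using k(2) e(2) by simp
qed

theorem corollary1p3:
  shows "large (AutoGroup (free_group {..<3::nat})) \<and>
    \<not> property_T (AutoGroup (free_group {..<3::nat}))"
  using large_AutoGroup_F3 large_not_property_T[OF group_AutoGroup_F3] by blast

end
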